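(* Suppose $Y$ is a complete bipartite graph and $Y^f$ is a cyclic $r$-fold 2ev-cover of $Y$. Then $Y=K_{n,n}$ for some $n$ with $r\mid n$, and $Y^f$ is bipartite and distance-regular with diameter $4$.
   Context: All graphs are finite, simple and undirected. Covers: let $Y=(V,E)$ be a connected graph and $G$ a permutation group on $R=\{1,\dots,r\}$. A symmetric arc function is a function $f:V\times V\to G\cup\{0\}$ such that $f(u,v)=0$ if and only if $\{u,v\}\notin E$, and $f(u,v)=f(v,u)^{-1}$ whenever $f(u,v)\in G$. The cover $Y^f$ (of index $r$, or $r$-fold) is the graph with vertex set $V\times R$ in which $(v,j)$ is adjacent to $(u,k)$ exactly when $v$ is adjacent to $u$ in $Y$ and $f(u,v)j=k$. The function $f$ is normalized if $f(u,v)=\mathrm{id}$ for all edges $\{u,v\}$ of some spanning tree of $Y$. Denote by $\langle f\rangle$ the subgroup of $\mathrm{Sym}(r)$ generated by the (non-zero) values of $f$. Standing assumptions: $f$ is normalized and $\langle f\rangle$ acts regularly (i.e. simply transitively) on $\{1,\dots,r\}$. The cover is called cyclic if $\langle f\rangle$ is a cyclic group. Two-eigenvalue cover (2ev-cover): $\mathrm{Spec}(A)$ denotes the spectrum of $A$ as a multiset, and $A(\cdot)$ the adjacency matrix. One has $\mathrm{Spec}(A(Y))\subseteq\mathrm{Spec}(A(Y^f))$ as multisets, and $Y^f$ is a 2ev-cover of $Y$ if the multiset difference $\mathrm{Spec}(A(Y^f))\setminus\mathrm{Spec}(A(Y))$ has exactly two distinct elements. Distance-regular has its standard meaning: a connected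 graph of diameter $d$ such that for vertices $v,w$ at distance $i$, the numbers of neighbours of $w$ at distance $i+1$, respectively $i-1$, from $v$ depend only on $i$. *)

theory Defs
  imports
    "Graph_Theory.Graph_Theory"
    "Jordan_Normal_Form.Char_Poly"
    "HOL-Algebra.Sym_Groups"
    "HOL-Algebra.Elementary_Groups"
begin

text \<open>A finite simple undirected graph is a \<^locale>\<open>pair_graph\<close>, that is, a finite loop-free
  symmetric digraph whose arcs are pairs of vertices. Zero is encoded as \<^const>\<open>None\<close> in arc
  functions, and permutations of \<open>{1..r}\<close> are the elements of the carrier of \<open>sym_group r\<close>.\<close>

subsection \<open>Spanning trees\<close>

text \<open>The library's \<^const>\<open>tree\<close> and \<^const>\<open>spanning_tree\<close> only exclude \<^emph>\<open>directed\<close> cycles: a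
  symmetric digraph with an edge is never a \<^const>\<open>tree\<close>, while an acyclically oriented triangle
  is one. In a symmetric digraph without multiple arcs, the directed cycles of length at least
  3 are the cycles of the underlying graph.\<close>

definition undirected_spanning_tree :: "'v pair_pre_digraph \<Rightarrow> 'v pair_pre_digraph \<Rightarrow> bool" where
  "undirected_spanning_tree T Y \<longleftrightarrow>
     pair_graph T \<and> spanning (with_proj T) (with_proj Y) \<and>
     Digraph_Component.connected (with_proj T) \<and>
     \<not> (\<exists>c. pre_digraph.cycle (with_proj T) c \<and> 3 \<le> length c)"

subsection \<open>Covers\<close>

definition symmetric_arc_function ::
    "'v pair_pre_digraph \<Rightarrow> nat \<Rightarrow> (nat \<Rightarrow> nat) set \<Rightarrow> ('v \<Rightarrow> 'v \<Rightarrow> (nat \<Rightarrow> nat) option) \<Rightarrow> bool" where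
  "symmetric_arc_function Y r G f \<longleftrightarrow>
     (\<forall>u\<in>pverts Y. \<forall>v\<in>pverts Y.
        f u v \<in> insert None (Some ` G) \<and>
        (f u v = None \<longleftrightarrow> (u, v) \<notin> parcs Y) \<and>
        f u v = map_option (\<lambda>g. inv\<^bsub>sym_group r\<^esub> g) (f v u))"

definition cover ::
    "'v pair_pre_digraph \<Rightarrow> nat \<Rightarrow> ('v \<Rightarrow> 'v \<Rightarrow> (nat \<Rightarrow> nat) option) \<Rightarrow> ('v \<times> nat) pair_pre_digraph" where
  "cover Y r f =
     \<lparr> pverts = pverts Y \<times> {1..r},
       parcs = {((v, j), (u, k)) | v j u k. j \<in> {1..r} \<and> k \<in> {1..r} \<and>
                  (v, u) \<in> parcs Y \<and> (\<exists>g. f u v = Some g \<and> g j = k)} \<rparr>"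

definition normalized :: "'v pair_pre_digraph \<Rightarrow> ('v \<Rightarrow> 'v \<Rightarrow> (nat \<Rightarrow> nat) option) \<Rightarrow> bool" where
  "normalized Y f \<longleftrightarrow>
     (\<exists>T. undirected_spanning_tree T Y \<and> (\<forall>(u, v)\<in>parcs T. f u v = Some id))"

definition arc_function_group ::
    "'v pair_pre_digraph \<Rightarrow> nat \<Rightarrow> ('v \<Rightarrow> 'v \<Rightarrow> (nat \<Rightarrow> nat) option) \<Rightarrow> (nat \<Rightarrow> nat) monoid" where
  "arc_function_group Y r f =
     subgroup_generated (sym_group r) {g. \<exists>u\<in>pverts Y. \<exists>v\<in>pverts Y. f u v = Some g}"

definition acts_regularly :: "(nat \<Rightarrow> nat) monoid \<Rightarrow> nat \<Rightarrow> bool" where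
  "acts_regularly H r \<longleftrightarrow> (\<forall>i\<in>{1..r}. \<forall>j\<in>{1..r}. \<exists>!g. g \<in> carrier H \<and> g i = j)"

subsection \<open>Spectra\<close>

definition adj_mat :: "'v pair_pre_digraph \<Rightarrow> 'v list \<Rightarrow> complex mat" where
  "adj_mat Y vs =
     mat (length vs) (length vs) (\<lambda>(i, j). if (vs ! i, vs ! j) \<in> parcs Y then 1 else 0)"

text \<open>The multiset of eigenvalues with their (algebraic, equivalently geometric)
  multiplicities. The ordering of the vertices is irrelevant, see \<open>Spec_eq\<close> below.\<close>

definition Spec :: "'v pair_pre_digraph \<Rightarrow> complex multiset" where
  "Spec Y = proots (char_poly (adj_mat Y (SOME vs. distinct vs \<and> set vs = pverts Y)))"

lemma similar_adj_mat:
  assumes "distinct vs" "distinct ws" "set vs = set ws"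
  shows "similar_mat (adj_mat Y vs) (adj_mat Y ws)"
proof -
  have len: "length ws = length vs"
    using assms by (metis distinct_card)
  define n where "n = length vs"
  define P :: "'a list \<Rightarrow> 'a list \<Rightarrow> complex mat"
    where "P xs ys = mat n n (\<lambda>(i, j). if xs ! i = ys ! j then 1 else 0)" for xs ys
  define D where "D xs \<longleftrightarrow> distinct xs \<and> set xs = set vs \<and> length xs = n" for xs :: "'a list"
  have reindex: "(\<Sum>k = 0..<n. h (xs ! k)) = (\<Sum>x\<in>set vs. h x)"
    if "D xs" for xs and h :: "'a \<Rightarrow> complex"
  proof -
    have "bij_betw ((!) xs) {0..<n} (set vs)"
      using that bij_betw_nth[of xs "{0..<n}" "set vs"] by (auto simp: D_def atLeast0LessThan)
    then show ?thesis by (rule sum.reindex_bij_betw)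
  qed
  have nth: "xs ! i \<in> set vs" if "D xs" "i < n" for xs i
    using that by (metis D_def nth_mem)
  have PP: "P xs ys * P ys xs = 1\<^sub>m n" if D: "D xs" "D ys" for xs ys
  proof (rule eq_matI)
    fix i j assume "i < dim_row (1\<^sub>m n :: complex mat)" "j < dim_col (1\<^sub>m n :: complex mat)"
    then have ij: "i < n" "j < n" by auto
    have "(P xs ys * P ys xs) $$ (i, j) =
        (\<Sum>k = 0..<n. (\<lambda>y. (if xs ! i = y then 1 else 0) * (if y = xs ! j then 1 else 0)) (ys ! k))"
      using ij by (simp add: P_def scalar_prod_def)
    also have "\<dots> = (\<Sum>y\<in>set vs. (if xs ! i = y then 1 else 0) * (if y = xs ! j then 1 else 0))"
      by (rule reindex[OF D(2)])
    also have "\<dots> = (\<Sum>y\<in>set vs. if xs ! i = y then (if xs ! i = xs ! j then 1 else 0) else 0)"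
      by (rule sum.cong) auto
    also have "\<dots> = (if xs ! i = xs ! j then 1 else 0)"
      using nth[OF D(1) ij(1)] by simp
    also have "\<dots> = (1\<^sub>m n :: complex mat) $$ (i, j)"
      using D ij by (simp add: D_def nth_eq_iff_index_eq)
    finally show "(P xs ys * P ys xs) $$ (i, j) = (1\<^sub>m n :: complex mat) $$ (i, j)" .
  qed (simp_all add: P_def)
  have Dv: "D vs" and Dw: "D ws"
    using assms len by (auto simp: D_def n_def)
  have car: "P xs ys \<in> carrier_mat n n" for xs ys by (simp add: P_def)
  have carA: "adj_mat Y vs \<in> carrier_mat n n" "adj_mat Y ws \<in> carrier_mat n n"
    by (simp_all add: adj_mat_def n_def len)
  have eq: "adj_mat Y vs * P vs ws = P vs ws * adj_mat Y ws"
  proof (rule eq_matI)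
    fix i j
    assume "i < dim_row (P vs ws * adj_mat Y ws)" "j < dim_col (P vs ws * adj_mat Y ws)"
    then have ij: "i < n" "j < n" by (auto simp: P_def adj_mat_def n_def len)
    have "(adj_mat Y vs * P vs ws) $$ (i, j) =
        (\<Sum>k = 0..<n. (\<lambda>y. (if (vs ! i, y) \<in> parcs Y then 1 else 0) * (if y = ws ! j then 1 else 0)) (vs ! k))"
      using ij by (simp add: P_def adj_mat_def scalar_prod_def n_def[symmetric])
    also have "\<dots> = (\<Sum>y\<in>set vs. (if (vs ! i, y) \<in> parcs Y then 1 else 0) * (if y = ws ! j then 1 else 0))"
      by (rule reindex[OF Dv])
    also have "\<dots> = (\<Sum>y\<in>set vs. if y = ws ! j then (if (vs ! i, ws ! j) \<in> parcs Y then 1 else 0) else 0)"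
      by (rule sum.cong) auto
    also have "\<dots> = (if (vs ! i, ws ! j) \<in> parcs Y then 1 else 0)"
      using nth[OF Dw ij(2)] by simp
    finally have 1: "(adj_mat Y vs * P vs ws) $$ (i, j) = (if (vs ! i, ws ! j) \<in> parcs Y then 1 else 0)" .
    have "(P vs ws * adj_mat Y ws) $$ (i, j) =
        (\<Sum>k = 0..<n. (\<lambda>y. (if vs ! i = y then 1 else 0) * (if (y, ws ! j) \<in> parcs Y then 1 else 0)) (ws ! k))"
      using ij by (simp add: P_def adj_mat_def scalar_prod_def n_def[symmetric] len)
    also have "\<dots> = (\<Sum>y\<in>set vs. (if vs ! i = y then 1 else 0) * (if (y, ws ! j) \<in> parcs Y then 1 else 0))"
      by (rule reindex[OF Dw])
    also have "\<dots> = (\<Sum>y\<in>set vs. if vs ! i = y then (if (vs ! i, ws ! j) \<in> parcs Y then 1 else 0) else 0)"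
      by (rule sum.cong) auto
    also have "\<dots> = (if (vs ! i, ws ! j) \<in> parcs Y then 1 else 0)"
      using nth[OF Dv ij(1)] by simp
    finally show "(adj_mat Y vs * P vs ws) $$ (i, j) = (P vs ws * adj_mat Y ws) $$ (i, j)"
      using 1 by simp
  qed (simp_all add: P_def adj_mat_def n_def len)
  have "P vs ws * adj_mat Y ws * P ws vs = adj_mat Y vs * P vs ws * P ws vs"
    by (simp add: eq)
  also have "\<dots> = adj_mat Y vs * (P vs ws * P ws vs)"
    using carA car by (meson assoc_mult_mat)
  also have "\<dots> = adj_mat Y vs"
    using PP[OF Dv Dw] carA by simp
  finally have "adj_mat Y vs = P vs ws * adj_mat Y ws * P ws vs" by simp
  then have "similar_mat_wit (adj_mat Y vs) (adj_mat Y ws) (P vs ws) (P ws vs)"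
    using carA car PP[OF Dv Dw] PP[OF Dw Dv] by (intro similar_mat_witI[of _ _ n]) auto
  then show ?thesis by (auto simp: similar_mat_def)
qed

lemma Spec_eq:
  assumes "distinct vs" "set vs = pverts Y"
  shows "Spec Y = proots (char_poly (adj_mat Y vs))"
proof -
  define ws where "ws = (SOME ws. distinct ws \<and> set ws = pverts Y)"
  have "distinct ws \<and> set ws = pverts Y"
    unfolding ws_def by (rule someI[of _ vs]) (use assms in auto)
  then have "char_poly (adj_mat Y ws) = char_poly (adj_mat Y vs)"
    by (intro char_poly_similar similar_adj_mat) (use assms in auto)
  then show ?thesis by (simp add: Spec_def ws_def)
qed

definition two_ev_cover ::
    "'v pair_pre_digraph \<Rightarrow> nat \<Rightarrow> ('v \<Rightarrow> 'v \<Rightarrow> (nat \<Rightarrow> nat) option) \<Rightarrow> bool" where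
  "two_ev_cover Y r f \<longleftrightarrow> card (set_mset (Spec (cover Y r f) - Spec Y)) = 2"

subsection \<open>Distances, bipartiteness and distance-regularity\<close>

definition graph_dist :: "'v pair_pre_digraph \<Rightarrow> 'v \<Rightarrow> 'v \<Rightarrow> ereal" where
  "graph_dist Y = wf_digraph.\<mu> (with_proj Y) (\<lambda>_. 1)"

definition graph_diameter :: "'v pair_pre_digraph \<Rightarrow> ereal" where
  "graph_diameter Y = (SUP (u, v)\<in>pverts Y \<times> pverts Y. graph_dist Y u v)"

definition bipartite :: "'v pair_pre_digraph \<Rightarrow> bool" where
  "bipartite Y \<longleftrightarrow>
     (\<exists>U W. pverts Y = U \<union> W \<and> U \<inter> W = {} \<and> parcs Y \<subseteq> U \<times> W \<union> W \<times> U)"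

definition distance_regular :: "'v pair_pre_digraph \<Rightarrow> bool" where
  "distance_regular Y \<longleftrightarrow>
     pair_graph Y \<and> Digraph_Component.connected (with_proj Y) \<and>
     (\<forall>i::nat. \<exists>b c. \<forall>v\<in>pverts Y. \<forall>w\<in>pverts Y. graph_dist Y v w = ereal (real i) \<longrightarrow>
        card {u. (w, u) \<in> parcs Y \<and> graph_dist Y v u = ereal (real i + 1)} = b \<and>
        card {u. (w, u) \<in> parcs Y \<and> graph_dist Y v u = ereal (real i - 1)} = c)"

end

theory Submission
  imports Defs "Jordan_Normal_Form.Schur_Decomposition"
begin

text \<open>Let \<open>A\<close> be the adjacency matrix of the cover and \<open>P\<close> the averaging over fibres. They
  commute, and \<open>A\<close> acts on the kernel of \<open>P\<close> with exactly the eigenvalues in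
  the multiset difference of the spectra. As \<open>A\<close> is symmetric and there are only two of these, some quadratic
  polynomial \<open>A\<^sup>2 - s A + p\<close> vanishes on the kernel of \<open>P\<close>, that is, its entries
  depend on the column only through its fibre. Comparing entries: an edge and a non-edge
  between two adjacent fibres give \<open>s = 0\<close>; the diagonal gives that every degree is \<open>-p\<close>, so the two
  sides of the base have equal size \<open>n\<close>; and for distinct fibres on the same side every two vertices
  have the same number of common neighbours, which is thus \<open>n / r\<close>. All distances and
  intersection numbers can then be read off. Normalization and regularity exclude \<open>n = 1\<close>.\<close>

subsection \<open>Real symmetric matrices\<close>

text \<open>The trace of the square is computed twice: by symmetry it is the sum of the squared
  entries, and a Schur triangular form, whose diagonal vanishes here, makes it 0.\<close>

lemma real_symmetric_eq_zero:
  fixes S :: "real mat"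
  assumes S: "S \<in> carrier_mat n n" and sym: "transpose_mat S = S"
    and ev: "\<And>\<mu>. eigenvalue (map_mat complex_of_real S) \<mu> \<Longrightarrow> \<mu> = 0"
  shows "S = 0\<^sub>m n n"
proof -
  define M where "M = map_mat complex_of_real S"
  have M: "M \<in> carrier_mat n n" using S by (simp add: M_def)
  obtain es where es: "char_poly M = (\<Prod>a\<leftarrow>es. [:- a, 1:])"
    using char_poly_factorized[OF M] by blast
  obtain B where B: "B \<in> carrier_mat n n" "upper_triangular B" "similar_mat M B"
    using schur_decomposition_exists[OF M es] by blast
  have diag: "B $$ (i, i) = 0" if "i < n" for i
  proof -
    have "B $$ (i, i) \<in> set (diag_mat B)"
      using B(1) that by (auto simp: diag_mat_def)
    then have "poly (char_poly B) (B $$ (i, i)) = 0"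
      by (auto simp: char_poly_upper_triangular[OF B(1,2)] poly_prod_list prod_list_zero_iff)
    then have "eigenvalue M (B $$ (i, i))"
      by (simp add: eigenvalue_root_char_poly[OF M] char_poly_similar[OF B(3)])
    then show ?thesis using ev by (simp add: M_def)
  qed
  obtain P Q where PQ: "similar_mat_wit M B P Q"
    using B(3) by (auto simp: similar_mat_def)
  have n: "n = dim_row M" using M by simp
  note wit = similar_mat_witD[OF n PQ]
  define tr :: "complex mat \<Rightarrow> complex" where "tr X = (\<Sum>i<n. X $$ (i, i))" for X
  have tr_prod: "tr (X * Z) = (\<Sum>i<n. \<Sum>k<n. X $$ (i, k) * Z $$ (k, i))"
    if "X \<in> carrier_mat n n" "Z \<in> carrier_mat n n" for X Z
    unfolding tr_def using that
    by (intro sum.cong refl) (simp add: scalar_prod_def atLeast0LessThan)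
  have tr_comm: "tr (X * Z) = tr (Z * X)"
    if "X \<in> carrier_mat n n" "Z \<in> carrier_mat n n" for X Z
    unfolding tr_prod[OF that] tr_prod[OF that(2,1)]
    by (subst sum.swap) (simp add: mult.commute)
  have "M * M = P * (B * B) * Q"
  proof -
    have "M * M = P * B * (Q * P) * B * Q"
      using wit(4-7) by (simp add: wit(3) assoc_mult_mat[of _ n n _ n _ n])
    also have "\<dots> = P * (B * B) * Q"
      using wit(4-7) by (simp add: wit(2) assoc_mult_mat[of _ n n _ n _ n])
    finally show ?thesis .
  qed
  \<comment> \<open>Cyclicity of the trace moves \<open>P\<close> to the right end, where
    \<open>Q * P\<close> is the identity.\<close>
  then have "tr (M * M) = tr (B * B * (Q * P))"
    using wit(4-7) tr_comm[of P "B * B * Q"] by (simp add: assoc_mult_mat[of _ n n _ n _ n])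
  also have "\<dots> = tr (B * B)"
    using B(1) by (simp add: wit(2))
  also have "\<dots> = 0"
    unfolding tr_prod[OF B(1) B(1)]
  \<comment> \<open>For distinct indices one of the two factors lies below the diagonal; for equal
    ones both are diagonal entries, hence 0.\<close>
  proof (intro sum.neutral ballI)
    fix i k assume "i \<in> {..<n}" "k \<in> {..<n}"
    then show "B $$ (i, k) * B $$ (k, i) = 0"
      using B(1,2) diag by (cases i k rule: linorder_cases) (auto simp: upper_triangular_def)
  qed
  finally have "(\<Sum>i<n. \<Sum>k<n. M $$ (i, k) * M $$ (k, i)) = 0"
    by (simp add: tr_prod[OF M M])
  moreover have "M $$ (i, k) * M $$ (k, i) = complex_of_real ((S $$ (i, k))\<^sup>2)" if "i < n" "k < n" for i k
  proof -
    have "S $$ (k, i) = S $$ (i, k)"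
      using arg_cong[OF sym, of "\<lambda>X. X $$ (i, k)"] S that by simp
    then show ?thesis using that S by (simp add: M_def power2_eq_square)
  qed
  ultimately have "complex_of_real (\<Sum>i<n. \<Sum>k<n. (S $$ (i, k))\<^sup>2) = 0"
    by simp
  then have "(\<Sum>i<n. \<Sum>k<n. (S $$ (i, k))\<^sup>2) = 0"
    by (simp only: of_real_eq_0_iff)
  then have "\<forall>i<n. \<forall>k<n. S $$ (i, k) = 0"
    by (simp add: sum_nonneg_eq_0_iff sum_nonneg)
  then show ?thesis using S by (intro eq_matI) auto
qed

text \<open>The Hermitian form \<open>z\<close> equals its own conjugate and is \<open>\<mu>\<close>
  times the positive number \<open>q\<close>. This later allows two possibly complex numbers to be
  replaced by their real parts.\<close>

lemma real_symmetric_eigenvalue_real: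
  fixes S :: "real mat"
  assumes S: "S \<in> carrier_mat n n" and sym: "transpose_mat S = S"
    and ev: "eigenvector (map_mat complex_of_real S) w \<mu>"
  shows "Im \<mu> = 0"
proof -
  have w: "w \<in> carrier_vec n" "w \<noteq> 0\<^sub>v n" and
    eq: "map_mat complex_of_real S *\<^sub>v w = \<mu> \<cdot>\<^sub>v w"
    using ev S by (auto simp: eigenvector_def)
  have row: "(\<Sum>k<n. of_real (S $$ (i, k)) * w $ k) = \<mu> * w $ i" if "i < n" for i
    using arg_cong[OF eq, of "\<lambda>x. x $ i"] that S w
    by (simp add: scalar_prod_def atLeast0LessThan)
  define q where "q = (\<Sum>i<n. (cmod (w $ i))\<^sup>2)"
  define z where "z = (\<Sum>i<n. \<Sum>k<n. cnj (w $ i) * of_real (S $$ (i, k)) * w $ k)"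
  have "z = (\<Sum>i<n. cnj (w $ i) * (\<Sum>k<n. of_real (S $$ (i, k)) * w $ k))"
    by (simp add: z_def sum_distrib_left mult.assoc)
  also have "\<dots> = (\<Sum>i<n. \<mu> * of_real ((cmod (w $ i))\<^sup>2))"
  proof (intro sum.cong refl)
    fix i assume "i \<in> {..<n}"
    then show "cnj (w $ i) * (\<Sum>k<n. of_real (S $$ (i, k)) * w $ k) = \<mu> * of_real ((cmod (w $ i))\<^sup>2)"
      by (subst row) (simp_all add: complex_norm_square del: of_real_power)
  qed
  also have "\<dots> = \<mu> * of_real q"
    by (simp add: q_def sum_distrib_left)
  finally have z: "z = \<mu> * of_real q" .
  have S_sym: "S $$ (k, i) = S $$ (i, k)" if "i < n" "k < n" for i k
    using arg_cong[OF sym, of "\<lambda>X. X $$ (i, k)"] S that by simp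
  have "cnj z = (\<Sum>i<n. \<Sum>k<n. w $ i * of_real (S $$ (i, k)) * cnj (w $ k))"
    by (simp add: z_def)
  also have "\<dots> = (\<Sum>k<n. \<Sum>i<n. w $ i * of_real (S $$ (i, k)) * cnj (w $ k))"
    by (rule sum.swap)
  also have "\<dots> = z"
    unfolding z_def by (intro sum.cong refl) (simp add: S_sym mult.commute mult.left_commute)
  finally have "Im z = 0"
    by (simp add: complex_eq_iff)
  moreover have "q \<noteq> 0"
  proof
    assume "q = 0"
    then have "\<forall>i<n. w $ i = 0" by (simp add: q_def sum_nonneg_eq_0_iff)
    then show False using w by auto
  qed
  ultimately show ?thesis using z by simp
qed

section \<open>A quadratic relation on the kernel of a commuting projection\<close>

lemma smult_mat_mult_vec:
  fixes A :: "'a :: comm_ring_1 mat"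
  assumes "A \<in> carrier_mat nr nc" "v \<in> carrier_vec nc"
  shows "(k \<cdot>\<^sub>m A) *\<^sub>v v = k \<cdot>\<^sub>v (A *\<^sub>v v)"
  using assms by (intro eq_vecI) (simp_all add: smult_scalar_prod_distrib[where n=nc])

text \<open>The operator \<open>(S - a)(S - b)(1 - P)\<close> is real symmetric. An eigenvector of it for
  \<open>\<mu> \<noteq> 0\<close> lies in the kernel of \<open>P\<close>, and factoring \<open>(x - a)(x - b) - \<mu>\<close> then yields an eigenvector of
  \<open>S\<close> in that kernel whose eigenvalue is neither \<open>a\<close> nor \<open>b\<close>.\<close>

lemma two_eigenvalues_on_kernel:
  fixes S P :: "real mat"
  assumes S: "S \<in> carrier_mat n n" and P: "P \<in> carrier_mat n n"
    and S_sym: "transpose_mat S = S" and P_sym: "transpose_mat P = P"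
    and idem: "P * P = P" and comm: "S * P = P * S"
    and ev: "\<And>w \<mu>. eigenvector (map_mat complex_of_real S) w \<mu> \<Longrightarrow>
                map_mat complex_of_real P *\<^sub>v w = 0\<^sub>v n \<Longrightarrow> \<mu> \<in> {\<theta>, \<tau>}"
  obtains s p where "S * S - s \<cdot>\<^sub>m S + p \<cdot>\<^sub>m 1\<^sub>m n = (S * S - s \<cdot>\<^sub>m S + p \<cdot>\<^sub>m 1\<^sub>m n) * P"
proof -
  \<comment> \<open>Real parts keep \<open>M\<close> a real matrix. Eigenvalues of \<open>S\<close>
    are real, so any that equals \<open>\<theta>\<close> or \<open>\<tau>\<close> equals
    \<open>a\<close> or \<open>b\<close>.\<close>
  define a b where "a = Re \<theta>" and "b = Re \<tau>"
  define M where "M = S * S - (a + b) \<cdot>\<^sub>m S + (a * b) \<cdot>\<^sub>m 1\<^sub>m n"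
  have M: "M \<in> carrier_mat n n" using S by (simp add: M_def)
  let ?Z = "1\<^sub>m n - P"
  let ?c = "map_mat complex_of_real"
  have Z: "?Z \<in> carrier_mat n n" using P by (rule minus_carrier_mat)
  note assoc = assoc_mult_mat[of _ n n _ n _ n]
  have SSP: "S * S * P = P * (S * S)"
  proof -
    have "S * S * P = S * (P * S)" using S P by (simp add: assoc comm)
    also have "\<dots> = P * S * S" using S P by (metis assoc_mult_mat comm)
    also have "\<dots> = P * (S * S)" using S P by (simp add: assoc)
    finally show ?thesis .
  qed
  have MP: "M * P = P * M"
    using S P unfolding M_def
    by (simp add: minus_carrier_mat add_mult_distrib_mat[where nr=n and n=n and nc=n] minus_mult_distrib_mat[where nr=n and n=n and nc=n]
        mult_add_distrib_mat[where nr=n and n=n and nc=n] mult_minus_distrib_mat[where nr=n and n=n and nc=n]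
        mult_smult_assoc_mat[where nr=n and n=n and nc=n] mult_smult_distrib[where nr=n and n=n and nc=n] SSP comm)
  have M_sym: "transpose_mat M = M"
  proof -
    have "transpose_mat (S * S) = S * S"
      using S by (simp add: transpose_mult[where nr=n and n=n and nc=n] S_sym)
    moreover have "S $$ (j, i) = S $$ (i, j)" if "i < n" "j < n" for i j
      using arg_cong[OF S_sym, of "\<lambda>X. X $$ (i, j)"] S that by simp
    moreover have "(S * S) $$ (j, i) = (S * S) $$ (i, j)" if "i < n" "j < n" for i j
      using arg_cong[OF \<open>transpose_mat (S * S) = S * S\<close>, of "\<lambda>X. X $$ (i, j)"] S that
      by (simp del: index_mult_mat(1))
    ultimately show ?thesis
      using S unfolding M_def by (intro eq_matI) (auto simp del: index_mult_mat(1))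
  qed
  have MZ: "M * ?Z = M - M * P" "?Z * M = M - M * P"
    using M P by (simp_all add: mult_minus_distrib_mat[where nr=n and n=n and nc=n] minus_mult_distrib_mat[where nr=n and n=n and nc=n] MP)
  have Z_sym: "transpose_mat ?Z = ?Z"
    using P by (simp add: transpose_minus[where nr=n and nc=n] P_sym)
  \<comment> \<open>\<open>T\<close> is symmetric because the symmetric matrices \<open>M\<close>
    and \<open>1 - P\<close> commute. The claim amounts to \<open>T\<close> being zero.\<close>
  define T where "T = M * ?Z"
  have T: "T \<in> carrier_mat n n" using M Z by (simp add: T_def)
  have T_sym: "transpose_mat T = T"
    unfolding T_def transpose_mult[OF M Z] M_sym Z_sym by (simp add: MZ)
  have PZ: "P * ?Z = 0\<^sub>m n n"
    using P by (simp add: mult_minus_distrib_mat[where nr=n and n=n and nc=n] idem)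
  have PT: "P * T = 0\<^sub>m n n"
  proof -
    have "P * T = P * M * ?Z" using M P Z by (simp add: T_def assoc del: minus_carrier_mat)
    also have "\<dots> = M * (P * ?Z)" using M P Z by (simp add: MP[symmetric] assoc)
    finally show ?thesis using M by (simp add: PZ)
  qed
  have "T = 0\<^sub>m n n"
  proof (rule real_symmetric_eq_zero[OF T T_sym])
    fix \<mu> assume "eigenvalue (?c T) \<mu>"
    then obtain v where v: "v \<in> carrier_vec n" "v \<noteq> 0\<^sub>v n" "?c T *\<^sub>v v = \<mu> \<cdot>\<^sub>v v"
      using T by (auto simp: eigenvalue_def eigenvector_def)
    show "\<mu> = 0"
    proof (rule ccontr)
      assume \<mu>: "\<mu> \<noteq> 0"
      have car: "?c S \<in> carrier_mat n n" "?c P \<in> carrier_mat n n" "?c T \<in> carrier_mat n n"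
        "?c M \<in> carrier_mat n n"
        using S P T M by auto
      have zero: "?c (0\<^sub>m n n) = 0\<^sub>m n n" by auto
      \<comment> \<open>As \<open>P * T\<close> is zero, applying \<open>P\<close> to the
        eigenvector equation gives \<open>\<mu>\<close> times \<open>P v\<close> = 0.\<close>
      have "\<mu> \<cdot>\<^sub>v (?c P *\<^sub>v v) = ?c P *\<^sub>v (?c T *\<^sub>v v)"
        using car v by (simp add: mult_mat_vec[of _ n n])
      also have "\<dots> = ?c (P * T) *\<^sub>v v"
        using P T car v by (simp add: of_real_hom.mat_hom_mult[OF P T] assoc_mult_mat_vec[of _ n n])
      also have "\<dots> = 0\<^sub>v n" using v(1) unfolding PT zero by (intro eq_vecI) auto
      finally have "\<mu> \<cdot>\<^sub>v (?c P *\<^sub>v v) = 0\<^sub>v n" .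
      then have Pv: "?c P *\<^sub>v v = 0\<^sub>v n"
        using \<mu> car v by (auto simp: vec_eq_iff)
      have ZC: "?c ?Z = 1\<^sub>m n - ?c P"
        using P by (intro eq_matI) auto
      have Zv: "?c ?Z *\<^sub>v v = v"
        using car v unfolding ZC by (simp add: minus_mult_distrib_mat_vec[of _ n n] Pv)
      have Mv: "?c M *\<^sub>v v = \<mu> \<cdot>\<^sub>v v"
        using Zv v(1,3) M Z by (simp add: T_def of_real_hom.mat_hom_mult[OF M Z] assoc_mult_mat_vec[of _ n n _ n])
      have CM: "?c M = ?c S * ?c S - of_real (a + b) \<cdot>\<^sub>m ?c S + of_real (a * b) \<cdot>\<^sub>m 1\<^sub>m n"
        unfolding of_real_hom.mat_hom_mult[OF S S, symmetric] M_def
        using S by (intro eq_matI) auto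
      define Sv where "Sv = ?c S *\<^sub>v v"
      define SSv where "SSv = ?c S *\<^sub>v Sv"
      have dims: "Sv \<in> carrier_vec n" "SSv \<in> carrier_vec n"
        using car(1) v(1) by (auto simp: Sv_def SSv_def intro!: mult_mat_vec_carrier)
      have CMv: "?c M *\<^sub>v v = SSv - of_real (a + b) \<cdot>\<^sub>v Sv + of_real (a * b) \<cdot>\<^sub>v v"
        unfolding CM using car v(1)
        by (simp add: minus_carrier_mat add_mult_distrib_mat_vec[of _ n n] minus_mult_distrib_mat_vec[of _ n n]
            smult_mat_mult_vec[where nr=n and nc=n] assoc_mult_mat_vec[of _ n n _ n] SSv_def Sv_def)
      then have quad: "SSv $ i - of_real (a + b) * Sv $ i + of_real (a * b) * v $ i = \<mu> * v $ i"
        if "i < n" for i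
        using arg_cong[OF Mv, of "\<lambda>x. x $ i"] that dims v(1) unfolding CMv by simp
      \<comment> \<open>\<open>\<alpha>\<close> and \<open>\<beta>\<close> are the roots of (x -
        a)(x - b) - \<mu>, so (S - \<alpha>)(S - \<beta>) annihilates \<open>v\<close>.\<close>
      define D where "D = csqrt ((of_real (a + b))\<^sup>2 - 4 * (of_real (a * b) - \<mu>))"
      define \<alpha> \<beta> where "\<alpha> = (of_real (a + b) + D) / 2" and "\<beta> = (of_real (a + b) - D) / 2"
      have sum: "\<alpha> + \<beta> = of_real (a + b)"
        by (simp add: \<alpha>_def \<beta>_def field_simps)
      have "\<alpha> * \<beta> = ((of_real (a + b))\<^sup>2 - D\<^sup>2) / 4"
        by (simp add: \<alpha>_def \<beta>_def power2_eq_square algebra_simps)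
      also have "(of_real (a + b))\<^sup>2 - D\<^sup>2 = 4 * (of_real (a * b) - \<mu>)"
        by (simp add: D_def)
      finally have prod: "\<alpha> * \<beta> = of_real (a * b) - \<mu>"
        by (metis nonzero_mult_div_cancel_left zero_neq_numeral)
      \<comment> \<open>The polynomial takes the nonzero value -\<mu> at \<open>a\<close> and at
        \<open>b\<close>, so its roots differ from both.\<close>
      have root: "z \<noteq> \<alpha> \<and> z \<noteq> \<beta>" if "z = of_real a \<or> z = of_real b" for z
      proof -
        have "(z - \<alpha>) * (z - \<beta>) = z\<^sup>2 - (\<alpha> + \<beta>) * z + \<alpha> * \<beta>"
          by (simp add: power2_eq_square algebra_simps)
        also have "\<dots> = - \<mu>"
          using that unfolding sum prod by (auto simp: power2_eq_square algebra_simps)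
        finally show ?thesis using \<mu> by auto
      qed
      have ev': "z = of_real a \<or> z = of_real b"
        if "eigenvector (?c S) w z" "?c P *\<^sub>v w = 0\<^sub>v n" for w z
      proof -
        have "Im z = 0" by (rule real_symmetric_eigenvalue_real[OF S S_sym that(1)])
        with ev[OF that] show ?thesis by (auto simp: a_def b_def complex_eq_iff)
      qed
      \<comment> \<open>With \<open>u\<close> = (S - \<beta>) v, either \<open>v\<close> is an
        eigenvector for \<open>\<beta>\<close> or \<open>u\<close> is one for
        \<open>\<alpha>\<close>. Both lie in the kernel of \<open>P\<close>, which \<open>S\<close>
        preserves.\<close>
      define u where "u = Sv - \<beta> \<cdot>\<^sub>v v"
      have u: "u \<in> carrier_vec n" using dims v(1) by (simp add: u_def)
      show False
      proof (cases "u = 0\<^sub>v n")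
        case True
        have "Sv $ i = \<beta> * v $ i" if "i < n" for i
          using arg_cong[OF True, of "\<lambda>x. x $ i"] that dims v(1) by (simp add: u_def)
        then have "Sv = \<beta> \<cdot>\<^sub>v v" using dims v(1) by auto
        then have "eigenvector (?c S) v \<beta>"
          using v S by (simp add: eigenvector_def Sv_def)
        from ev'[OF this Pv] root show False by blast
      next
        case False
        have "?c S *\<^sub>v u = SSv - \<beta> \<cdot>\<^sub>v Sv"
          using car(1) v(1) dims unfolding u_def SSv_def
          by (simp add: mult_minus_distrib_mat_vec[of _ n n] mult_mat_vec[of _ n n] Sv_def)
        also have "\<dots> = \<alpha> \<cdot>\<^sub>v u"
        proof (rule eq_vecI)
          fix i assume "i < dim_vec (\<alpha> \<cdot>\<^sub>v u)"
          then have i: "i < n" using u by simp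
          have "SSv $ i = (\<alpha> + \<beta>) * Sv $ i - \<alpha> * \<beta> * v $ i"
            unfolding sum prod using quad[OF i] by (simp add: algebra_simps)
          then show "(SSv - \<beta> \<cdot>\<^sub>v Sv) $ i = (\<alpha> \<cdot>\<^sub>v u) $ i"
            using i dims v(1) by (simp add: u_def algebra_simps)
        qed (use dims u in auto)
        finally have "eigenvector (?c S) u \<alpha>"
          using u False S by (simp add: eigenvector_def)
        moreover have "?c P *\<^sub>v u = 0\<^sub>v n"
        proof -
          have "?c P *\<^sub>v Sv = ?c (P * S) *\<^sub>v v"
            using car v(1) by (simp add: Sv_def of_real_hom.mat_hom_mult[OF P S] assoc_mult_mat_vec[of _ n n _ n])
          also have "\<dots> = ?c S *\<^sub>v (?c P *\<^sub>v v)"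
            using car v(1) by (simp add: comm[symmetric] of_real_hom.mat_hom_mult[OF S P] assoc_mult_mat_vec[of _ n n _ n])
          also have "\<dots> = 0\<^sub>v n"
            using car(1) unfolding Pv by auto
          finally show ?thesis
            using car(2) v(1) dims unfolding u_def
            by (simp add: mult_minus_distrib_mat_vec[of _ n n] mult_mat_vec[of _ n n] Pv) auto
        qed
        ultimately show False using ev' root by blast
      qed
    qed
  qed
  then have zero: "M - M * P = 0\<^sub>m n n" by (simp add: T_def MZ)
  have "M = M * P"
  proof (rule eq_matI)
    fix i j assume ij: "i < dim_row (M * P)" "j < dim_col (M * P)"
    then show "M $$ (i, j) = (M * P) $$ (i, j)"
      using arg_cong[OF zero, of "\<lambda>X. X $$ (i, j)"] M P by simp
  qed (use M P in auto)
  then show ?thesis using that[of "a + b" "a * b"] by (simp add: M_def)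
qed

section \<open>Splitting off a quotient matrix from the characteristic polynomial\<close>

text \<open>If \<open>Q = [1 K]\<close>, conjugating \<open>A\<close> by the block matrix \<open>[[1, K], [0, 1]]\<close> gives a block lower
  triangular matrix with diagonal blocks \<open>B\<close> and \<open>C\<close>.\<close>

lemma char_poly_quotient:
  fixes A :: "complex mat"
  assumes A: "A \<in> carrier_mat (n + m) (n + m)" and B: "B \<in> carrier_mat n n"
    and Q: "Q \<in> carrier_mat n (n + m)"
    and Q1: "\<And>i j. i < n \<Longrightarrow> j < n \<Longrightarrow> Q $$ (i, j) = (if i = j then 1 else 0)"
    and QA: "Q * A = B * Q"
  obtains C where "C \<in> carrier_mat m m" "char_poly A = char_poly B * char_poly C"
    "\<And>w \<mu>. eigenvector A w \<mu> \<Longrightarrow> Q *\<^sub>v w = 0\<^sub>v n \<Longrightarrow> eigenvalue C \<mu>"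
proof -
  obtain A1 A2 A3 A4 where res: "split_block A n n = (A1, A2, A3, A4)"
    by (metis prod_cases4)
  have "dim_row A = n + m" "dim_col A = n + m" using A by auto
  note blk = split_block[OF res this]
  define K where "K = mat n m (\<lambda>(i, j). Q $$ (i, j + n))"
  have K: "K \<in> carrier_mat n m" by (simp add: K_def)
  define L where "L = four_block_mat (1\<^sub>m n) K (0\<^sub>m m n) (1\<^sub>m m)"
  define L' where "L' = four_block_mat (1\<^sub>m n) (- K) (0\<^sub>m m n) (1\<^sub>m m)"
  define C where "C = A4 - A3 * K"
  have C: "C \<in> carrier_mat m m" using blk(3,4) K by (auto simp: C_def)
  have L: "L \<in> carrier_mat (n + m) (n + m)" "L' \<in> carrier_mat (n + m) (n + m)"
    by (auto simp: L_def L'_def)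
  have "- 0\<^sub>m m n = (0\<^sub>m m n :: complex mat)" "- 0\<^sub>m m m = (0\<^sub>m m m :: complex mat)"
    by (auto intro: eq_matI)
  then have LL': "L * L' = 1\<^sub>m (n + m)" and L'L: "L' * L = 1\<^sub>m (n + m)"
    unfolding L_def L'_def using K
    by (subst mult_four_block_mat[where ?nr1.0=n and ?n1.0=n and ?n2.0=m and ?nr2.0=m and ?nc1.0=n and ?nc2.0=m];
        force simp: uminus_l_inv_mat[of K n m] comm_add_mat[of K n m "- K"])+
  have top: "(L * X) $$ (i, j) = (Q * X) $$ (i, j)"
    if "X \<in> carrier_mat (n + m) k" "i < n" "j < k" for X i j k
  proof -
    have "row L i = row Q i"
      using that(2) L Q Q1 by (intro eq_vecI) (auto simp: L_def K_def)
    then show ?thesis using that L Q by simp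
  qed
  have LA: "L * A = four_block_mat (A1 + K * A3) (A2 + K * A4) A3 A4"
    unfolding L_def using K blk(1-4)
    by (subst blk(5), subst mult_four_block_mat[where ?nr1.0=n and ?n1.0=n and ?n2.0=m and ?nr2.0=m and ?nc1.0=n and ?nc2.0=m])
       (auto simp: left_mult_zero_mat[of _ n] intro!: cong_four_block_mat)
  \<comment> \<open>The top \<open>n\<close> rows of \<open>L\<close> form \<open>Q\<close>, so the
    intertwining relation \<open>QA\<close> identifies the top of \<open>L * A\<close> with
    \<open>B * Q\<close>.\<close>
  have LA_top: "(L * A) $$ (i, j) = (\<Sum>k<n. B $$ (i, k) * Q $$ (k, j))" if "i < n" "j < n + m" for i j
    unfolding top[OF A that] QA using that B Q by (simp add: scalar_prod_def atLeast0LessThan)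
  have b1: "A1 + K * A3 = B"
  proof (rule eq_matI)
    fix i j assume "i < dim_row B" "j < dim_col B"
    then have ij: "i < n" "j < n" using B by auto
    have "(A1 + K * A3) $$ (i, j) = (L * A) $$ (i, j)"
      unfolding LA using ij blk(1-4) K by simp
    also have "\<dots> = (\<Sum>k<n. if k = j then B $$ (i, k) else 0)"
      using ij by (subst LA_top) (simp_all add: Q1 if_distrib cong: if_cong)
    finally show "(A1 + K * A3) $$ (i, j) = B $$ (i, j)" using ij by simp
  qed (use blk K B in auto)
  have b2: "A2 + K * A4 = B * K"
  proof (rule eq_matI)
    fix i j assume "i < dim_row (B * K)" "j < dim_col (B * K)"
    then have ij: "i < n" "j < m" using B K by auto
    have "(A2 + K * A4) $$ (i, j) = (L * A) $$ (i, j + n)"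
      unfolding LA using ij blk(1-4) K by simp
    also have "\<dots> = (B * K) $$ (i, j)"
      using ij B K by (subst LA_top) (auto simp: K_def scalar_prod_def atLeast0LessThan)
    finally show "(A2 + K * A4) $$ (i, j) = (B * K) $$ (i, j)" .
  qed (use blk K B in auto)
  \<comment> \<open>In \<open>L * A * L'\<close> the upper right block cancels to
    \<open>B * K - B * K\<close>, which leaves a block lower triangular matrix.\<close>
  define D where "D = four_block_mat B (0\<^sub>m n m) A3 C"
  have D: "D \<in> carrier_mat (n + m) (n + m)" using B C by (simp add: D_def)
  have D_eq: "L * A * L' = D"
  proof -
    have 1: "B * - K + B * K = 0\<^sub>m n m"
      using B K by (simp add: uminus_l_inv_mat)
    have 2: "A3 * - K + A4 = C"
      using blk(3,4) K by (intro eq_matI) (auto simp: C_def)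
    show ?thesis
      unfolding LA b1 b2 L'_def D_def using B K blk(3,4) 1 2
      by (subst mult_four_block_mat[where ?nr1.0=n and ?n1.0=n and ?n2.0=m and ?nr2.0=m and ?nc1.0=n and ?nc2.0=m])
         (auto intro!: cong_four_block_mat)
  qed
  note assoc = assoc_mult_mat[of _ "n + m" "n + m" _ "n + m" _ "n + m"]
  have "A = L' * L * A * (L' * L)" using A by (simp add: L'L)
  also have "\<dots> = L' * D * L" using A L by (simp add: D_eq[symmetric] assoc)
  finally have A_eq: "A = L' * D * L" .
  have "similar_mat A D"
    unfolding similar_mat_def
    by (intro exI, rule similar_mat_witI[OF L'L LL' A_eq A D L(2,1)])
  then have "char_poly A = char_poly D" by (rule char_poly_similar)
  also have "\<dots> = char_poly B * char_poly C"
    using char_poly_factorized[OF B] char_poly_factorized[OF C]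
    by (intro char_poly_0_block'[OF D_def _ _ B blk(3) C]) auto
  finally have cp: "char_poly A = char_poly B * char_poly C" .
  \<comment> \<open>The first \<open>n\<close> coordinates of \<open>L w\<close> are those of
    \<open>Q w\<close>, hence zero, so on the remaining part \<open>y\<close> the matrix
    \<open>D\<close> acts as \<open>C\<close>. Invertibility of \<open>L\<close> keeps
    \<open>y\<close> nonzero.\<close>
  have "eigenvalue C \<mu>" if ew: "eigenvector A w \<mu>" and Qw: "Q *\<^sub>v w = 0\<^sub>v n" for w \<mu>
  proof -
    have w: "w \<in> carrier_vec (n + m)" "w \<noteq> 0\<^sub>v (n + m)" "A *\<^sub>v w = \<mu> \<cdot>\<^sub>v w"
      using ew A by (auto simp: eigenvector_def)
    define y where "y = vec_last w m"
    have y: "y \<in> carrier_vec m" by (simp add: y_def)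
    have Lw: "L *\<^sub>v w = 0\<^sub>v n @\<^sub>v y"
    proof (rule eq_vecI)
      fix i assume i: "i < dim_vec (0\<^sub>v n @\<^sub>v y)"
      show "(L *\<^sub>v w) $ i = (0\<^sub>v n @\<^sub>v y) $ i"
      proof (cases "i < n")
        case True
        have "row L i = row Q i"
          using True L Q Q1 by (intro eq_vecI) (auto simp: L_def K_def)
        then have "(L *\<^sub>v w) $ i = (Q *\<^sub>v w) $ i" using True L Q by simp
        then show ?thesis using True by (simp add: Qw)
      next
        case False
        then have i': "i - n < m" "i < n + m" using i y by auto
        have "(L *\<^sub>v w) $ i = (\<Sum>k = 0..<n + m. L $$ (i, k) * w $ k)"
          using i' L w(1) by (simp add: scalar_prod_def)
        also have "\<dots> = (\<Sum>k = 0..<n + m. if k = i then w $ k else 0)"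
          using False i' by (intro sum.cong refl) (auto simp: L_def)
        also have "\<dots> = w $ i" using i' by simp
        finally show ?thesis using False i' w(1) by (simp add: y_def vec_last_def)
      qed
    qed (use L y in auto)
    have w_eq: "w = L' *\<^sub>v (L *\<^sub>v w)"
      using L w(1) L'L by (simp add: assoc_mult_mat_vec[of _ "n + m" "n + m" _ "n + m", symmetric])
    have "y \<noteq> 0\<^sub>v m"
    proof
      assume "y = 0\<^sub>v m"
      then have "L *\<^sub>v w = 0\<^sub>v (n + m)" unfolding Lw by auto
      then have "w = 0\<^sub>v (n + m)" using w_eq L by auto
      then show False using w by simp
    qed
    moreover have "D *\<^sub>v (L *\<^sub>v w) = \<mu> \<cdot>\<^sub>v (L *\<^sub>v w)"
    proof -
      have "D *\<^sub>v (L *\<^sub>v w) = L *\<^sub>v (A *\<^sub>v (L' *\<^sub>v (L *\<^sub>v w)))"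
        using A L w(1) by (simp add: D_eq[symmetric] assoc_mult_mat_vec[of _ "n + m" "n + m" _ "n + m"])
      also have "\<dots> = L *\<^sub>v (\<mu> \<cdot>\<^sub>v w)" by (simp add: w_eq[symmetric] w(3))
      finally show ?thesis using L w(1) by (simp add: mult_mat_vec[of _ "n + m" "n + m"])
    qed
    then have eq: "(B *\<^sub>v 0\<^sub>v n + 0\<^sub>m n m *\<^sub>v y) @\<^sub>v (A3 *\<^sub>v 0\<^sub>v n + C *\<^sub>v y) = \<mu> \<cdot>\<^sub>v (0\<^sub>v n @\<^sub>v y)"
      unfolding Lw D_def
      by (subst (asm) four_block_mat_mult_vec[OF B zero_carrier_mat blk(3) C zero_carrier_vec y])
    have "C *\<^sub>v y = \<mu> \<cdot>\<^sub>v y"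
    proof (rule eq_vecI)
      fix i assume "i < dim_vec (\<mu> \<cdot>\<^sub>v y)"
      then have i: "i < m" using y by simp
      show "(C *\<^sub>v y) $ i = (\<mu> \<cdot>\<^sub>v y) $ i"
        using arg_cong[OF eq, of "\<lambda>x. x $ (n + i)"] i y B C blk(3) by simp
    qed (use C y in auto)
    ultimately show ?thesis
      using C y by (auto simp: eigenvalue_def eigenvector_def)
  qed
  with C cp show ?thesis using that by blast
qed

subsection \<open>Spectra of covers\<close>

lemma pair_graphD:
  assumes "pair_graph Y"
  shows "finite (pverts Y)" "(u, v) \<in> parcs Y \<Longrightarrow> (v, u) \<in> parcs Y" "(u, u) \<notin> parcs Y"
proof -
  have *: "pair_fin_digraph Y" "pair_sym_digraph Y" "pair_loopfree_digraph Y"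
    using assms by (simp_all add: pair_graph_def pair_digraph_def pair_pseudo_graph_def)
  show "finite (pverts Y)" by (rule pair_fin_digraph.pair_finite_verts[OF *(1)])
  show "(u, v) \<in> parcs Y \<Longrightarrow> (v, u) \<in> parcs Y" by (rule pair_sym_digraph.arcs_symmetric[OF *(2)])
  show "(u, u) \<notin> parcs Y" using pair_loopfree_digraph.pair_no_loops[OF *(3), of "(u, u)"] by auto
qed

text \<open>Abstracts from the permutations: the later arguments see a cover only as a graph on
  fibres, with a perfect matching between adjacent fibres and no arcs elsewhere.\<close>

locale graph_cover =
  fixes Y :: "'v pair_pre_digraph" and X :: "('v \<times> nat) pair_pre_digraph" and r :: nat
  assumes base: "pair_graph Y"
    and verts: "pverts X = pverts Y \<times> {1..r}"
    and arc_verts: "(x, y) \<in> parcs X \<Longrightarrow> x \<in> pverts X"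
    and arc_sym: "(x, y) \<in> parcs X \<Longrightarrow> (y, x) \<in> parcs X"
    and card_fibre: "x \<in> pverts X \<Longrightarrow> v \<in> pverts Y \<Longrightarrow>
      card {y. (x, y) \<in> parcs X \<and> fst y = v} = (if (fst x, v) \<in> parcs Y then 1 else 0)"
begin

lemmas [simp del] = sum_of_bool_eq sum_mult_of_bool_eq sum_of_bool_mult_eq

lemma finite_base: "finite (pverts Y)"
  and base_sym: "(u, v) \<in> parcs Y \<Longrightarrow> (v, u) \<in> parcs Y"
  and base_irrefl: "(u, u) \<notin> parcs Y"
  by (rule pair_graphD[OF base]; assumption)+

lemma finite_verts: "finite (pverts X)"
  using finite_base by (simp add: verts)

lemma arc_verts2: "(x, y) \<in> parcs X \<Longrightarrow> y \<in> pverts X"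
  using arc_verts arc_sym by blast

text \<open>The arc witnesses a neighbour in the fibre over \<open>fst y\<close>, which excludes the
  value 0 in \<open>card_fibre\<close>.\<close>

lemma arc_base:
  assumes "(x, y) \<in> parcs X"
  shows "(fst x, fst y) \<in> parcs Y"
proof -
  let ?S = "{z. (x, z) \<in> parcs X \<and> fst z = fst y}"
  have "finite ?S" by (rule finite_subset[OF _ finite_verts]) (auto dest: arc_verts2)
  moreover have "y \<in> ?S" using assms by simp
  ultimately have pos: "0 < card ?S" unfolding card_gt_0_iff by blast
  have "fst y \<in> pverts Y"
    using arc_verts2[OF assms] by (simp add: verts mem_Times_iff)
  note fibre = card_fibre[OF arc_verts[OF assms] this]
  show ?thesis
  proof (rule ccontr)
    assume "(fst x, fst y) \<notin> parcs Y"
    with fibre pos show False by (simp only: if_False less_irrefl)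
  qed
qed

definition common_nbrs :: "'v \<times> nat \<Rightarrow> 'v \<times> nat \<Rightarrow> ('v \<times> nat) set" where
  "common_nbrs x y = {z. (x, z) \<in> parcs X \<and> (z, y) \<in> parcs X}"

lemma pair_graph_total: "pair_graph X"
proof
  show "finite (pverts X)" by (rule finite_verts)
  show "finite (parcs X)"
    by (rule finite_subset[OF _ finite_cartesian_product[OF finite_verts finite_verts]])
      (auto dest: arc_verts arc_verts2)
  \<comment> \<open>A loop would project to a loop of the base.\<close>
  show "fst e \<noteq> snd e" if "e \<in> parcs X" for e
    using arc_base[of "fst e" "snd e"] that base_irrefl by (metis prod.collapse)
  show "symmetric (with_proj X)"
    using arc_sym by (auto simp: symmetric_def sym_def)
qed (auto dest: arc_verts arc_verts2)

section \<open>From two new eigenvalues to a relation constant on fibres\<close>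

text \<open>Eigenvectors of the adjacency matrix that sum to zero on every fibre have their eigenvalues
  in the multiset difference. Hence \<open>A\<^sup>2 - s A + p\<close> vanishes on all vectors with zero fibre
  sums, which means that its rows are constant on fibres.\<close>

lemma fibre_constant:
  assumes two: "card (set_mset (Spec X - Spec Y)) = 2"
  obtains s p :: real where "2 \<le> r"
    "\<And>x v k k'. x \<in> pverts X \<Longrightarrow> v \<in> pverts Y \<Longrightarrow> k \<in> {1..r} \<Longrightarrow> k' \<in> {1..r} \<Longrightarrow>
      real (card (common_nbrs x (v, k)))
        - s * of_bool ((x, (v, k)) \<in> parcs X) + p * of_bool (x = (v, k)) =
      real (card (common_nbrs x (v, k')))
        - s * of_bool ((x, (v, k')) \<in> parcs X) + p * of_bool (x = (v, k'))"
proof -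
  obtain vs where vs: "distinct vs" "set vs = pverts Y"
    using finite_distinct_list[OF finite_base] by blast
  define N where "N = length vs"
  \<comment> \<open>The position in the fibre varies slowest, so the first \<open>N\<close> vertices
    are the copies \<open>(v, 1)\<close> in the order of \<open>vs\<close>. This gives
    \<open>Q\<close> its leading identity block.\<close>
  define ws where "ws = map (\<lambda>(k, v). (v, k)) (List.product [1..<Suc r] vs)"
  have ws: "distinct ws" "set ws = pverts X" "length ws = N * r"
    using vs distinct_product[of "[1..<Suc r]" vs]
    by (auto simp: ws_def distinct_map inj_on_def verts N_def length_product)
  \<comment> \<open>For \<open>r\<close> = 0 the cover has no vertices and its spectrum is
    empty.\<close>
  have "r \<noteq> 0"
  proof
    assume "r = 0"
    then have "ws = []" by (simp add: ws_def)
    then have "Spec X = {#}" using Spec_eq[OF ws(1,2)]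
      by (simp add: adj_mat_def char_poly_def char_poly_matrix_def det_dim_zero)
    then show False using two by simp
  qed
  define m where "m = N * (r - 1)"
  have len: "length ws = N + m"
    using \<open>r \<noteq> 0\<close> by (cases r) (simp_all add: ws m_def)
  have ws_nth: "ws ! i = (vs ! i, 1)" if "i < N" for i
    using that \<open>r \<noteq> 0\<close> unfolding ws_def N_def
    by (subst nth_map) (auto simp: product_nth length_product less_le_trans[of _ "length vs"] nth_append split: nat.splits)
  have ws_in: "ws ! i \<in> pverts X" if "i < N + m" for i
    using that len ws(2) nth_mem by metis
  have fst_ws: "fst (ws ! i) \<in> pverts Y" if "i < N + m" for i
    using ws_in[OF that] by (auto simp: verts)
  have vs_in: "vs ! i \<in> pverts Y" if "i < N" for i
    using that vs(2) nth_mem N_def by metis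
  have reindex: "(\<Sum>i<N + m. h (ws ! i)) = (\<Sum>x\<in>pverts X. h x)" for h :: "_ \<Rightarrow> 'b :: comm_monoid_add"
    using ws len by (intro sum.reindex_bij_betw bij_betw_nth) auto
  have reindexY: "(\<Sum>i<N. h (vs ! i)) = (\<Sum>x\<in>pverts Y. h x)" for h :: "_ \<Rightarrow> 'b :: comm_monoid_add"
    using vs by (intro sum.reindex_bij_betw bij_betw_nth) (auto simp: N_def)
  have fibre_sum: "(\<Sum>y\<in>pverts X. of_bool ((x, y) \<in> parcs X) * of_bool (fst y = v))
      = (of_bool ((fst x, v) \<in> parcs Y) :: 'b :: semiring_1)"
    if "x \<in> pverts X" "v \<in> pverts Y" for x v
  proof -
    have "(\<Sum>y\<in>pverts X. of_bool ((x, y) \<in> parcs X) * of_bool (fst y = v)) =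
        (\<Sum>y\<in>pverts X \<inter> {y. (x, y) \<in> parcs X \<and> fst y = v}. 1 :: 'b)"
      using finite_verts by (subst sum.inter_restrict) (auto intro!: sum.cong simp del: sum_constant)
    also have "pverts X \<inter> {y. (x, y) \<in> parcs X \<and> fst y = v} = {y. (x, y) \<in> parcs X \<and> fst y = v}"
      by (auto dest: arc_verts2)
    finally show ?thesis using card_fibre[OF that] by simp
  qed
  \<comment> \<open>\<open>S\<close> is the adjacency matrix of the cover, \<open>P\<close> averages
    over fibres and \<open>Q\<close> sums over them, so \<open>P\<close> and \<open>Q\<close> have
    the same kernel.\<close>
  define S :: "real mat" where "S = mat (N + m) (N + m) (\<lambda>(i, j). of_bool ((ws ! i, ws ! j) \<in> parcs X))"
  define P :: "real mat" where "P = mat (N + m) (N + m) (\<lambda>(i, j). of_bool (fst (ws ! i) = fst (ws ! j)) / real r)"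
  define A where "A = map_mat complex_of_real S"
  define B where "B = adj_mat Y vs"
  define Q :: "complex mat" where "Q = mat N (N + m) (\<lambda>(i, j). of_bool (fst (ws ! j) = vs ! i))"
  have S: "S \<in> carrier_mat (N + m) (N + m)" and P: "P \<in> carrier_mat (N + m) (N + m)"
    and A: "A \<in> carrier_mat (N + m) (N + m)" and Q: "Q \<in> carrier_mat N (N + m)"
    and B: "B \<in> carrier_mat N N"
    by (simp_all add: S_def P_def A_def Q_def B_def adj_mat_def N_def)
  have arc_comm: "((x, y) \<in> parcs X) = ((y, x) \<in> parcs X)" for x y
    using arc_sym by blast
  have base_comm: "((x, y) \<in> parcs Y) = ((y, x) \<in> parcs Y)" for x y
    using base_sym by blast
  have S_sym: "transpose_mat S = S"
    by (intro eq_matI) (auto simp: S_def arc_comm)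
  have P_sym: "transpose_mat P = P"
    by (intro eq_matI) (auto simp: P_def)
  have SP: "(S * P) $$ (i, j) = of_bool ((fst (ws ! i), fst (ws ! j)) \<in> parcs Y) / real r"
    if "i < N + m" "j < N + m" for i j
  proof -
    have "(S * P) $$ (i, j) = (\<Sum>k<N + m. (\<lambda>y. of_bool ((ws ! i, y) \<in> parcs X) * of_bool (fst y = fst (ws ! j)) / real r) (ws ! k))"
      using that by (simp add: S_def P_def scalar_prod_def atLeast0LessThan)
    also have "\<dots> = (\<Sum>y\<in>pverts X. of_bool ((ws ! i, y) \<in> parcs X) * of_bool (fst y = fst (ws ! j))) / real r"
      by (subst reindex) (simp add: sum_divide_distrib)
    finally show ?thesis using that by (simp add: fibre_sum ws_in fst_ws)
  qed
  \<comment> \<open>\<open>P * S\<close> is the transpose of \<open>S * P\<close>, and the entries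
    computed in \<open>SP\<close> are symmetric in \<open>i\<close> and \<open>j\<close>.\<close>
  have comm: "S * P = P * S"
  proof (rule eq_matI)
    fix i j assume "i < dim_row (P * S)" "j < dim_col (P * S)"
    then have ij: "i < N + m" "j < N + m" using S P by auto
    have "(P * S) $$ (i, j) = transpose_mat (P * S) $$ (j, i)"
      using ij S P by simp
    also have "transpose_mat (P * S) = S * P"
      by (simp add: transpose_mult[OF P S] S_sym P_sym)
    finally show "(S * P) $$ (i, j) = (P * S) $$ (i, j)"
      using ij by (simp add: SP base_comm)
  qed (use S P in auto)
  have idem: "P * P = P"
  proof (rule eq_matI)
    fix i j assume "i < dim_row P" "j < dim_col P"
    then have ij: "i < N + m" "j < N + m" using P by auto
    have "(P * P) $$ (i, j) = (\<Sum>k<N + m. (\<lambda>y. of_bool (fst (ws ! i) = fst y) * of_bool (fst y = fst (ws ! j)) / (real r)\<^sup>2) (ws ! k))"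
      using ij by (simp add: P_def scalar_prod_def atLeast0LessThan power2_eq_square)
    also have "\<dots> = (\<Sum>y\<in>pverts X. of_bool (fst (ws ! i) = fst y) * of_bool (fst y = fst (ws ! j)) / (real r)\<^sup>2)"
      by (rule reindex)
    also have "\<dots> = (\<Sum>v\<in>pverts Y. \<Sum>k\<in>{1..r}. of_bool (fst (ws ! i) = v) * of_bool (v = fst (ws ! j)) / (real r)\<^sup>2)"
      unfolding verts by (simp only: sum.cartesian_product case_prod_unfold)
    also have "\<dots> = (\<Sum>v\<in>pverts Y. if v = fst (ws ! i) then of_bool (v = fst (ws ! j)) / real r else 0)"
      by (intro sum.cong refl) (auto simp: power2_eq_square)
    also have "\<dots> = P $$ (i, j)"
      using ij finite_base by (simp add: P_def fst_ws)
    finally show "(P * P) $$ (i, j) = P $$ (i, j)" .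
  qed (use P in auto)
  have A_adj: "A = adj_mat X ws"
    by (intro eq_matI) (auto simp: A_def S_def adj_mat_def len)
  have QA: "Q * A = B * Q"
  proof (rule eq_matI)
    fix i j assume "i < dim_row (B * Q)" "j < dim_col (B * Q)"
    then have ij: "i < N" "j < N + m" using B Q by auto
    have "(Q * A) $$ (i, j) = (\<Sum>k<N + m. (\<lambda>y. of_bool ((ws ! j, y) \<in> parcs X) * of_bool (fst y = vs ! i)) (ws ! k))"
      using ij by (auto simp: Q_def A_def S_def scalar_prod_def atLeast0LessThan arc_comm intro!: sum.cong)
    also have "\<dots> = of_bool ((fst (ws ! j), vs ! i) \<in> parcs Y)"
      using ij by (subst reindex) (simp add: fibre_sum ws_in vs_in)
    finally have 1: "(Q * A) $$ (i, j) = of_bool ((fst (ws ! j), vs ! i) \<in> parcs Y)" .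
    have "(B * Q) $$ (i, j) = (\<Sum>k<N. (\<lambda>v. of_bool ((vs ! i, v) \<in> parcs Y) * of_bool (fst (ws ! j) = v)) (vs ! k))"
      using ij by (auto simp: Q_def B_def adj_mat_def N_def[symmetric] scalar_prod_def atLeast0LessThan intro!: sum.cong)
    also have "\<dots> = (\<Sum>v\<in>pverts Y. if v = fst (ws ! j) then of_bool ((vs ! i, v) \<in> parcs Y) else 0)"
      by (subst reindexY) (auto intro!: sum.cong)
    also have "\<dots> = of_bool ((vs ! i, fst (ws ! j)) \<in> parcs Y)"
      using ij finite_base by (simp add: fst_ws)
    finally show "(Q * A) $$ (i, j) = (B * Q) $$ (i, j)"
      using 1 by (simp add: base_comm)
  qed (use A B Q in auto)
  have Q1: "Q $$ (i, j) = (if i = j then 1 else 0)" if "i < N" "j < N" for i j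
    using that vs(1) by (auto simp: Q_def ws_nth nth_eq_iff_index_eq N_def)
  obtain C where C: "C \<in> carrier_mat m m" "char_poly A = char_poly B * char_poly C"
    "\<And>w \<mu>. eigenvector A w \<mu> \<Longrightarrow> Q *\<^sub>v w = 0\<^sub>v N \<Longrightarrow> eigenvalue C \<mu>"
    using char_poly_quotient[OF A B Q Q1 QA] by blast
  have nz: "char_poly B \<noteq> 0" "char_poly C \<noteq> 0"
    using degree_monic_char_poly[OF B] degree_monic_char_poly[OF C(1)] by auto
  \<comment> \<open>The factor \<open>char_poly B\<close> accounts for the base spectrum, which
    leaves exactly the roots of \<open>char_poly C\<close> with their multiplicities.\<close>
  have diff: "Spec X - Spec Y = proots (char_poly C)"
    using Spec_eq[OF ws(1,2)] Spec_eq[OF vs] C(2) nz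
    by (simp add: A_adj[symmetric] B_def[symmetric] proots_mult)
  obtain \<theta> \<tau> where roots: "set_mset (proots (char_poly C)) = {\<theta>, \<tau>}"
    using two unfolding diff by (meson card_2_iff)
  \<comment> \<open>For \<open>r\<close> = 1 the matrix \<open>C\<close> is empty and has no
    eigenvalue.\<close>
  have r2: "2 \<le> r"
  proof (rule ccontr)
    assume "\<not> 2 \<le> r"
    then have "m = 0" using \<open>r \<noteq> 0\<close> by (simp add: m_def)
    then have "char_poly C = 1"
      using C(1) by (simp add: char_poly_def char_poly_matrix_def det_dim_zero)
    then show False using roots by simp
  qed
  have ev: "\<mu> \<in> {\<theta>, \<tau>}"
    if w: "eigenvector (map_mat complex_of_real S) w \<mu>"
      and Pw: "map_mat complex_of_real P *\<^sub>v w = 0\<^sub>v (N + m)" for w \<mu>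
  proof -
    have wc: "w \<in> carrier_vec (N + m)" using w S by (simp add: eigenvector_def)
    have "Q *\<^sub>v w = 0\<^sub>v N"
    proof (rule eq_vecI)
      fix i assume "i < dim_vec (0\<^sub>v N :: complex vec)"
      then have i: "i < N" by simp
      have "(Q *\<^sub>v w) $ i = (\<Sum>j<N + m. of_bool (vs ! i = fst (ws ! j)) * w $ j)"
        using i wc by (auto simp: Q_def scalar_prod_def atLeast0LessThan intro!: sum.cong)
      \<comment> \<open>By the choice of \<open>ws\<close>, the first \<open>N\<close> rows of
        \<open>P\<close> are the rows of \<open>Q\<close> divided by \<open>r\<close>.\<close>
      also have "\<dots> = of_nat r * (map_mat complex_of_real P *\<^sub>v w) $ i"
        using i wc \<open>r \<noteq> 0\<close>
        by (auto simp: P_def scalar_prod_def atLeast0LessThan ws_nth sum_distrib_left intro!: sum.cong)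
      finally show "(Q *\<^sub>v w) $ i = 0\<^sub>v N $ i" using i by (simp add: Pw)
    qed (use Q in auto)
    then have "eigenvalue C \<mu>" using C(3) w by (simp add: A_def)
    then have "\<mu> \<in> set_mset (proots (char_poly C))"
      using nz by (simp add: eigenvalue_root_char_poly[OF C(1)])
    then show ?thesis by (simp add: roots)
  qed
  obtain s p where M_eq: "S * S - s \<cdot>\<^sub>m S + p \<cdot>\<^sub>m 1\<^sub>m (N + m) = (S * S - s \<cdot>\<^sub>m S + p \<cdot>\<^sub>m 1\<^sub>m (N + m)) * P"
    by (rule two_eigenvalues_on_kernel[OF S P S_sym P_sym idem comm ev])
  define M where "M = S * S - s \<cdot>\<^sub>m S + p \<cdot>\<^sub>m 1\<^sub>m (N + m)"
  have M: "M \<in> carrier_mat (N + m) (N + m)" using S by (simp add: M_def)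
  have M_entry: "M $$ (i, j) = real (card {z. (ws ! i, z) \<in> parcs X \<and> (z, ws ! j) \<in> parcs X})
      - s * of_bool ((ws ! i, ws ! j) \<in> parcs X) + p * of_bool (ws ! i = ws ! j)"
    if "i < N + m" "j < N + m" for i j
  proof -
    have "(S * S) $$ (i, j) = (\<Sum>k<N + m. (\<lambda>z. of_bool ((ws ! i, z) \<in> parcs X \<and> (z, ws ! j) \<in> parcs X)) (ws ! k))"
      using that by (simp add: S_def scalar_prod_def atLeast0LessThan of_bool_conj)
    also have "\<dots> = real (card (pverts X \<inter> {z. (ws ! i, z) \<in> parcs X \<and> (z, ws ! j) \<in> parcs X}))"
      using finite_verts by (subst reindex) (simp add: of_bool_def sum.If_cases)
    also have "pverts X \<inter> {z. (ws ! i, z) \<in> parcs X \<and> (z, ws ! j) \<in> parcs X} =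
        {z. (ws ! i, z) \<in> parcs X \<and> (z, ws ! j) \<in> parcs X}"
      by (auto dest: arc_verts)
    finally show ?thesis
      using that S ws(1) len by (simp add: M_def S_def nth_eq_iff_index_eq del: index_mult_mat(1))
  qed
  \<comment> \<open>Columns of \<open>P\<close> within one fibre coincide, and
    \<open>M = M * P\<close> passes this on to \<open>M\<close>.\<close>
  have M_fibre: "M $$ (i, j) = M $$ (i, j')"
    if "i < N + m" "j < N + m" "j' < N + m" "fst (ws ! j) = fst (ws ! j')" for i j j'
  proof -
    have "col P j = col P j'"
      using that by (intro eq_vecI) (auto simp: P_def)
    then have "(M * P) $$ (i, j) = (M * P) $$ (i, j')"
      using that M P by simp
    then show ?thesis using M_eq by (simp add: M_def)
  qed
  show thesis
  proof (rule that[OF r2, of s p])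
    fix x v k k' assume *: "x \<in> pverts X" "v \<in> pverts Y" "k \<in> {1..r}" "k' \<in> {1..r}"
    have "x \<in> set ws" "(v, k) \<in> set ws" "(v, k') \<in> set ws"
      using * unfolding ws(2) by (auto simp: verts)
    then obtain i j j' where "i < N + m" "j < N + m" "j' < N + m"
      "ws ! i = x" "ws ! j = (v, k)" "ws ! j' = (v, k')"
      unfolding in_set_conv_nth len by blast
    then show "real (card (common_nbrs x (v, k)))
        - s * of_bool ((x, (v, k)) \<in> parcs X) + p * of_bool (x = (v, k)) =
      real (card (common_nbrs x (v, k')))
        - s * of_bool ((x, (v, k')) \<in> parcs X) + p * of_bool (x = (v, k'))"
      using M_fibre[of i j j'] M_entry[of i j] M_entry[of i j'] by (simp add: common_nbrs_def)
  qed
qed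

end

subsection \<open>Covers of complete bipartite graphs\<close>

text \<open>Along an arc \<open>d\<close> grows by at most one, so no walk from \<open>x\<close> to
  \<open>y\<close> is shorter than \<open>d y\<close>; descending through predecessors builds a walk
  of that length. A guessed distance formula can thus be verified locally.\<close>

lemma graph_dist_eqI:
  fixes d :: "'a \<Rightarrow> nat"
  assumes X: "pair_wf_digraph X" and x: "x \<in> pverts X"
    and zero: "\<And>y. y \<in> pverts X \<Longrightarrow> d y = 0 \<longleftrightarrow> y = x"
    and step: "\<And>y z. (y, z) \<in> parcs X \<Longrightarrow> d z \<le> Suc (d y)"
    and pred: "\<And>z k. z \<in> pverts X \<Longrightarrow> d z = Suc k \<Longrightarrow> \<exists>y. (y, z) \<in> parcs X \<and> d y = k"
    and y: "y \<in> pverts X"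
  shows "graph_dist X x y = ereal (real (d y))"
proof -
  interpret pair_wf_digraph X by (rule X)
  have cost: "awalk_cost (\<lambda>_. 1) p = real (length p)" for p :: "('a \<times> 'a) list"
    by (induction p) auto
  have lower: "d v \<le> d u + length p" if "awalk u p v" for u p v
    using that
  proof (induction p arbitrary: u)
    case (Cons e p)
    then have "(u, snd e) \<in> parcs X" "awalk (snd e) p v"
      by (auto simp: awalk_Cons_iff)
    then show ?case using Cons.IH[of "snd e"] step[of u "snd e"] by simp
  qed (simp add: awalk_Nil_iff)
  have upper: "\<exists>p. awalk x p z \<and> length p = d z" if "z \<in> pverts X" for z
    using that
  proof (induction "d z" arbitrary: z)
    case 0
    then have "z = x" using zero[of z] by simp
    then show ?case using 0 x by (intro exI[of _ "[]"]) (simp add: awalk_Nil_iff)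
  next
    case (Suc k)
    have "d z = Suc k" using Suc.hyps(2) by simp
    from pred[OF Suc.prems this] obtain v where v: "(v, z) \<in> parcs X" "d v = k"
      by blast
    have "v \<in> pverts X" using v(1) by (rule in_arcsD1)
    with v(2) obtain p where p: "awalk x p v" "length p = k"
      using Suc.hyps(1)[of v] by metis
    have "awalk v [(v, z)] z" using v(1) Suc.prems by (simp add: awalk_simps)
    with p(1) have "awalk x (p @ [(v, z)]) z" by (rule awalk_appendI)
    then show ?case using p(2) Suc.hyps(2) by (intro exI[of _ "p @ [(v, z)]"]) simp
  qed
  obtain p where p: "awalk x p y" "length p = d y" using upper[OF y] by blast
  show ?thesis
    unfolding graph_dist_def
  proof (rule antisym)
    show "\<mu> (\<lambda>_. 1) x y \<le> ereal (real (d y))"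
      using min_cost_le_walk_cost[OF p(1), of "\<lambda>_. 1"] by (simp add: cost p(2))
    show "ereal (real (d y)) \<le> \<mu> (\<lambda>_. 1) x y"
      unfolding \<mu>_def
    proof (rule INF_greatest)
      fix q assume "q \<in> {q. awalk x q y}"
      then have "d y \<le> length q" using lower[of x q y] zero[OF x] by simp
      then show "ereal (real (d y)) \<le> ereal (awalk_cost (\<lambda>_. 1) q)" by (simp add: cost)
    qed
  qed
qed

section \<open>Neighbourhoods in a cover\<close>

context graph_cover
begin

lemma finite_nbrs: "finite {z. (x, z) \<in> parcs X \<and> R z}"
  by (rule finite_subset[OF _ finite_verts]) (auto dest: arc_verts2)

lemma nbr_unique:
  assumes "(x, y) \<in> parcs X" "(x, z) \<in> parcs X" "fst y = fst z"
  shows "y = z"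
proof -
  let ?S = "{w. (x, w) \<in> parcs X \<and> fst w = fst z}"
  have "fst z \<in> pverts Y"
    using arc_verts2[OF assms(2)] by (simp add: verts mem_Times_iff)
  note card_fibre[OF arc_verts[OF assms(1)] this]
  then have "card ?S \<le> Suc 0" by (simp only: split: if_split) simp
  then have "\<forall>a\<in>?S. \<forall>b\<in>?S. a = b"
    by (simp only: card_le_Suc0_iff_eq[OF finite_nbrs])
  then show ?thesis using assms by blast
qed

lemma nbr_exists:
  assumes "x \<in> pverts X" "(fst x, v) \<in> parcs Y" "v \<in> pverts Y"
  obtains y where "(x, y) \<in> parcs X" "fst y = v"
proof -
  have "card {y. (x, y) \<in> parcs X \<and> fst y = v} = 1"
    using card_fibre[OF assms(1,3)] assms(2) by (simp only: if_True)
  then obtain y where "{y. (x, y) \<in> parcs X \<and> fst y = v} = {y}"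
    by (rule card_1_singletonE)
  then show ?thesis using that by blast
qed

text \<open>Projection to the base is a bijection between the two neighbourhoods, by
  \<open>nbr_unique\<close> and \<open>nbr_exists\<close>.\<close>

lemma card_nbrs:
  assumes "x \<in> pverts X"
  shows "card {z. (x, z) \<in> parcs X} = card {v \<in> pverts Y. (fst x, v) \<in> parcs Y}"
proof -
  have "inj_on fst {z. (x, z) \<in> parcs X}"
    using nbr_unique by (intro inj_onI) blast
  then have "card (fst ` {z. (x, z) \<in> parcs X}) = card {z. (x, z) \<in> parcs X}"
    by (rule card_image)
  moreover have "fst ` {z. (x, z) \<in> parcs X} = {v \<in> pverts Y. (fst x, v) \<in> parcs Y}"
  proof (intro equalityI subsetI)
    fix v assume "v \<in> {v \<in> pverts Y. (fst x, v) \<in> parcs Y}"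
    then obtain y where "(x, y) \<in> parcs X" "fst y = v"
      using nbr_exists[OF assms] by blast
    then show "v \<in> fst ` {z. (x, z) \<in> parcs X}" by blast
  next
    fix v assume "v \<in> fst ` {z. (x, z) \<in> parcs X}"
    then obtain y where y: "(x, y) \<in> parcs X" "v = fst y" by blast
    then show "v \<in> {v \<in> pverts Y. (fst x, v) \<in> parcs Y}"
      using arc_base[OF y(1)] arc_verts2[OF y(1)] by (simp add: verts mem_Times_iff)
  qed
  ultimately show ?thesis by simp
qed

end

section \<open>Degrees and common neighbours over a complete bipartite base\<close>

locale complete_bipartite_two_ev_cover =
  graph_cover Y X r for Y :: "'v pair_pre_digraph" and X :: "('v \<times> nat) pair_pre_digraph" and r :: nat +
  fixes U W :: "'v set"
  assumes parts: "pverts Y = U \<union> W" "U \<inter> W = {}" "U \<noteq> {}" "W \<noteq> {}"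
    and arcs: "parcs Y = U \<times> W \<union> W \<times> U"
    and two: "card (set_mset (Spec X - Spec Y)) = 2"
begin

definition deg :: nat where "deg = card U"

text \<open>The intersection number c_2. The division is exact once \<open>deg\<close> is at least
  2, as \<open>r_dvd\<close> shows.\<close>

definition common :: nat where "common = deg div r"

abbreviation same_side :: "'v \<times> nat \<Rightarrow> 'v \<times> nat \<Rightarrow> bool" where
  "same_side x y \<equiv> (fst x \<in> U \<longleftrightarrow> fst y \<in> U)"

lemma base_arc: "u \<in> pverts Y \<Longrightarrow> v \<in> pverts Y \<Longrightarrow> (u, v) \<in> parcs Y \<longleftrightarrow> (u \<in> U \<longleftrightarrow> v \<notin> U)"
  using parts arcs by auto

lemma arc_sides: "(x, y) \<in> parcs X \<Longrightarrow> \<not> same_side x y"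
  using arc_base[of x y] arcs parts by auto

text \<open>Everything comes from evaluating the relation of \<open>fibre_constant\<close> at two
  positions of one fibre, for a fibre opposite to \<open>x\<close>, the fibre of \<open>x\<close>
  itself, and another fibre on the side of \<open>x\<close>.\<close>

lemma
  shows r_ge_2: "2 \<le> r"
    and card_nbrs_eq: "x \<in> pverts X \<Longrightarrow> card {z. (x, z) \<in> parcs X} = deg"
    and card_common: "x \<in> pverts X \<Longrightarrow> y \<in> pverts X \<Longrightarrow> same_side x y \<Longrightarrow> fst x \<noteq> fst y \<Longrightarrow>
       r * card (common_nbrs x y) = deg"
    and card_parts: "card W = deg"
proof -
  obtain s p :: real where r2: "2 \<le> r" and
    inv: "\<And>x v k k'. x \<in> pverts X \<Longrightarrow> v \<in> pverts Y \<Longrightarrow> k \<in> {1..r} \<Longrightarrow> k' \<in> {1..r} \<Longrightarrow>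
      real (card (common_nbrs x (v, k)))
        - s * of_bool ((x, (v, k)) \<in> parcs X) + p * of_bool (x = (v, k)) =
      real (card (common_nbrs x (v, k')))
        - s * of_bool ((x, (v, k')) \<in> parcs X) + p * of_bool (x = (v, k'))"
    by (rule fibre_constant[OF two]) (rule that)
  show "2 \<le> r" by (rule r2)
  have other: "\<exists>k'\<in>{1..r}. k' \<noteq> k" for k
    using r2 by (intro bexI[of _ "if k = 1 then 2 else 1"]) auto
  obtain u w where uw: "u \<in> U" "w \<in> W" using parts by blast
  \<comment> \<open>The bipartition of the base lifts to the cover.\<close>
  have no_common_opp: "common_nbrs x y = {}" if "\<not> same_side x y" for x y
  proof -
    have "(z, y) \<notin> parcs X" if "(x, z) \<in> parcs X" for z
      using \<open>\<not> same_side x y\<close> arc_sides[OF that] arc_sides[of z y] by argo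
    then show ?thesis unfolding common_nbrs_def by blast
  qed
  \<comment> \<open>Exactly one position over \<open>w\<close> is adjacent to \<open>(u, 1)\<close>.
    Compared with any other position, only the term with \<open>s\<close> differs, as opposite
    vertices are distinct and have no common neighbours.\<close>
  have "s = 0"
  proof -
    have x: "(u, 1) \<in> pverts X" using uw parts r2 by (auto simp: verts)
    have w: "w \<in> pverts Y" "w \<notin> U" using uw parts by auto
    obtain y where y: "((u, 1), y) \<in> parcs X" "fst y = w"
      using nbr_exists[OF x, of w] uw arcs w by auto
    obtain k where k: "y = (w, k)" "k \<in> {1..r}"
      using y arc_verts2[OF y(1)] by (cases y) (auto simp: verts)
    obtain k' where k': "k' \<in> {1..r}" "k' \<noteq> k" using other by blast
    have na: "((u, 1), (w, k')) \<notin> parcs X"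
      using nbr_unique[OF y(1), of "(w, k')"] k k' by auto
    have opp: "common_nbrs (u, 1) (w, i) = {}" for i
      by (rule no_common_opp) (use uw w in simp)
    have "u \<noteq> w" using uw w by blast
    then show ?thesis
      using inv[OF x w(1) k(2) k'(1)] y(1)[unfolded k] na by (simp only: opp) simp
  qed
  \<comment> \<open>At the position of \<open>x\<close> itself all its neighbours are common and the
    term \<open>p\<close> appears; at another position of its fibre every term is 0.\<close>
  have deg': "real (card {z. (x, z) \<in> parcs X}) = - p" if x: "x \<in> pverts X" for x
  proof -
    obtain v j where vj: "x = (v, j)" "v \<in> pverts Y" "j \<in> {1..r}" using x by (cases x) (auto simp: verts)
    obtain k' where k': "k' \<in> {1..r}" "k' \<noteq> j" using other by blast
    have 1: "common_nbrs x (v, j) = {z. (x, z) \<in> parcs X}"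
      using arc_sym unfolding common_nbrs_def vj(1) by blast
    have "(z, (v, k')) \<notin> parcs X" if "(x, z) \<in> parcs X" for z
      using nbr_unique[OF arc_sym[OF that], of "(v, k')"] k' vj(1) by auto
    then have 2: "common_nbrs x (v, k') = {}" unfolding common_nbrs_def by blast
    have "x = (v, j)" "x \<noteq> (v, k')" using vj(1) k'(2) by auto
    then show ?thesis
      using inv[OF x vj(2,3) k'(1)] unfolding 1 2 by (simp add: \<open>s = 0\<close>)
  qed
  \<comment> \<open>Vertices over \<open>u\<close> have degree \<open>card W\<close> and those over
    \<open>w\<close> have degree \<open>card U\<close>, so both cardinalities are -p.\<close>
  have "{v \<in> pverts Y. (u, v) \<in> parcs Y} = W" "{v \<in> pverts Y. (w, v) \<in> parcs Y} = U"
    using uw parts arcs by auto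
  moreover have "(u, 1) \<in> pverts X" "(w, 1) \<in> pverts X" using uw parts r2 by (auto simp: verts)
  ultimately have cards: "real (card W) = - p" "real (card U) = - p"
    using card_nbrs[of "(u, 1)"] card_nbrs[of "(w, 1)"] deg'[of "(u, 1)"] deg'[of "(w, 1)"] by simp_all
  then show "card W = deg" by (simp add: deg_def)
  show card_deg: "card {z. (x, z) \<in> parcs X} = deg" if "x \<in> pverts X" for x
    using deg'[OF that] cards by (simp add: deg_def)
  show "r * card (common_nbrs x y) = deg"
    if x: "x \<in> pverts X" and y: "y \<in> pverts X" and side: "same_side x y" and neq: "fst x \<noteq> fst y" for x y
  proof -
    obtain v k where vk: "y = (v, k)" "v \<in> pverts Y" "k \<in> {1..r}" using y by (cases y) (auto simp: verts)
    let ?C = "\<lambda>k. common_nbrs x (v, k)"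
    have no_arc: "(x, (v, k')) \<notin> parcs X" for k' using arc_sides[of x "(v, k')"] side vk by auto
    have "x \<noteq> (v, k')" for k' using neq vk(1) by auto
    then have const: "card (?C k') = card (?C k)" if "k' \<in> {1..r}" for k'
      using inv[OF x vk(2) that vk(3)] no_arc by simp
    \<comment> \<open>Each neighbour of \<open>x\<close> is adjacent to exactly one position over
      \<open>v\<close>. This splits the neighbourhood into \<open>r\<close> classes, of equal size
      by \<open>const\<close>.\<close>
    have "{z. (x, z) \<in> parcs X} = (\<Union>k'\<in>{1..r}. ?C k')"
    proof (intro equalityI subsetI)
      fix z assume "z \<in> {z. (x, z) \<in> parcs X}"
      then have z: "(x, z) \<in> parcs X" by simp
      then have "(fst z, v) \<in> parcs Y"
        using arc_sides[OF z] side vk arc_verts2[OF z] base_arc[of "fst z" v] by (auto simp: verts)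
      then obtain y' where y': "(z, y') \<in> parcs X" "fst y' = v"
        using nbr_exists[OF arc_verts2[OF z] _ vk(2)] by blast
      then have "snd y' \<in> {1..r}" "y' = (v, snd y')"
        using arc_verts2[of z y'] by (auto simp: verts mem_Times_iff)
      then show "z \<in> (\<Union>k'\<in>{1..r}. ?C k')"
        using z y'(1) by (intro UN_I[of "snd y'"]) (simp_all add: common_nbrs_def)
    qed (auto simp: common_nbrs_def)
    then have "deg = card (\<Union>k'\<in>{1..r}. ?C k')" using card_deg[OF x] by (simp only:)
    also have "\<dots> = (\<Sum>k'\<in>{1..r}. card (?C k'))"
    proof (rule card_UN_disjoint)
      show "\<forall>k1\<in>{1..r}. \<forall>k2\<in>{1..r}. k1 \<noteq> k2 \<longrightarrow> ?C k1 \<inter> ?C k2 = {}"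
        using nbr_unique[of _ "(v, k1)" "(v, k2)" for k1 k2] by (auto simp: common_nbrs_def)
    qed (simp_all add: finite_nbrs common_nbrs_def)
    also have "\<dots> = r * card (?C k)" by (simp add: const)
    finally show ?thesis by (simp add: vk(1))
  qed
qed

lemma card_U: "card U = deg" by (simp add: deg_def)

lemma deg_pos: "0 < deg"
  using parts finite_base by (auto simp: deg_def card_gt_0_iff)

end

section \<open>Distances in the cover\<close>

locale nontrivial_cover =
  complete_bipartite_two_ev_cover Y X r U W
  for Y :: "'v pair_pre_digraph" and X :: "('v \<times> nat) pair_pre_digraph" and r :: nat and U W +
  assumes deg_ge_2: "2 \<le> deg"
begin

text \<open>This is where \<open>deg_ge_2\<close> enters: each side of the base has a second
  vertex.\<close>

lemma side_other:
  assumes "v \<in> pverts Y"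
  obtains v' where "v' \<in> pverts Y" "v' \<noteq> v" "v' \<in> U \<longleftrightarrow> v \<in> U"
proof -
  define S where "S = (if v \<in> U then U else W)"
  have "v \<in> S" "2 \<le> card S" using assms parts deg_ge_2 card_parts card_U by (auto simp: S_def)
  have "\<not> S \<subseteq> {v}"
  proof
    assume "S \<subseteq> {v}"
    then have "card S \<le> card {v}" by (rule card_mono[rotated]) simp
    with \<open>2 \<le> card S\<close> show False by simp
  qed
  then obtain v' where "v' \<in> S" "v' \<noteq> v" by blast
  then show ?thesis using that[of v'] assms parts by (auto simp: S_def split: if_splits)
qed

text \<open>The count in \<open>card_common\<close> requires two distinct fibres on one side, which
  \<open>side_other\<close> supplies. Positivity of \<open>deg\<close> then carries over to
  \<open>common\<close>.\<close>

lemma r_dvd: "r dvd deg" and common_pos: "0 < common"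
  and card_common_eq: "x \<in> pverts X \<Longrightarrow> y \<in> pverts X \<Longrightarrow> same_side x y \<Longrightarrow> fst x \<noteq> fst y \<Longrightarrow>
       card (common_nbrs x y) = common"
proof -
  show eq: "card (common_nbrs x y) = common"
    if "x \<in> pverts X" "y \<in> pverts X" "same_side x y" "fst x \<noteq> fst y" for x y
    unfolding common_def card_common[OF that, symmetric] using r_ge_2 by simp
  obtain u where "u \<in> pverts Y" using parts by blast
  moreover obtain v where "v \<in> pverts Y" "v \<noteq> u" "v \<in> U \<longleftrightarrow> u \<in> U"
    using side_other[OF \<open>u \<in> pverts Y\<close>] .
  ultimately have *: "r * common = deg"
    using card_common[of "(u, 1)" "(v, 1)"] eq[of "(u, 1)" "(v, 1)"] r_ge_2 by (auto simp: verts)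
  then show "r dvd deg" by (intro dvdI[of _ _ common]) simp
  show "0 < common" using * deg_pos by (intro gr0I) simp
qed

text \<open>Proposed closed formula for the distance, confirmed in \<open>graph_dist_cover\<close>.
  The sides decide the parity, and distinct vertices of one fibre are antipodal.\<close>

definition cover_dist :: "'v \<times> nat \<Rightarrow> 'v \<times> nat \<Rightarrow> nat" where
  "cover_dist x y = (if same_side x y then if fst x \<noteq> fst y then 2 else if x = y then 0 else 4
            else if (x, y) \<in> parcs X then 1 else 3)"

lemma cover_dist_same: "same_side x y \<Longrightarrow> cover_dist x y = (if fst x \<noteq> fst y then 2 else if x = y then 0 else 4)"
  unfolding cover_dist_def by (rule if_P)

lemma cover_dist_opposite: "\<not> same_side x y \<Longrightarrow> cover_dist x y = (if (x, y) \<in> parcs X then 1 else 3)"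
  unfolding cover_dist_def by (rule if_not_P)

text \<open>Arcs change sides, so only jumps by 3 have to be excluded: from 0 to 3, where
  \<open>y\<close> is \<open>x\<close>, and from 1 to 4, where \<open>nbr_unique\<close> at
  \<open>y\<close> forces \<open>x = z\<close>.\<close>

lemma cover_dist_step:
  assumes "(y, z) \<in> parcs X"
  shows "cover_dist x z \<le> Suc (cover_dist x y)"
proof (cases "same_side x y")
  case True
  then have "\<not> same_side x z" using arc_sides[OF assms] by argo
  then show ?thesis unfolding cover_dist_same[OF True] cover_dist_opposite[OF \<open>\<not> same_side x z\<close>]
    using assms by simp
next
  case False
  then have z: "same_side x z" using arc_sides[OF assms] by argo
  have "x = z" if "(x, y) \<in> parcs X" "fst x = fst z"
    using nbr_unique[OF arc_sym[OF that(1)] assms that(2)] .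
  then show ?thesis unfolding cover_dist_same[OF z] cover_dist_opposite[OF False] by auto
qed

text \<open>The predecessor is \<open>x\<close> itself at distance 1, a common neighbour at distance
  2, a neighbour of \<open>z\<close> over a second base vertex on the side of \<open>x\<close> at
  distance 3, and any neighbour of \<open>z\<close> at distance 4.\<close>

lemma cover_dist_pred:
  assumes x: "x \<in> pverts X" and z: "z \<in> pverts X" and dz: "cover_dist x z = Suc k"
  shows "\<exists>y. (y, z) \<in> parcs X \<and> cover_dist x y = k"
proof -
  have fx: "fst x \<in> pverts Y" and fz: "fst z \<in> pverts Y" using x z by (auto simp: verts)
  consider "\<not> same_side x z" "(x, z) \<in> parcs X" "k = 0" | "\<not> same_side x z" "(x, z) \<notin> parcs X" "k = 2"
    | "same_side x z" "fst x \<noteq> fst z" "k = 1" | "same_side x z" "fst x = fst z" "x \<noteq> z" "k = 3"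
    using dz by (auto simp: cover_dist_def split: if_splits)
  then show ?thesis
  proof cases
    case 1
    then show ?thesis by (intro exI[of _ x]) (simp add: cover_dist_def)
  next
    case 2
    obtain v where v: "v \<in> pverts Y" "v \<noteq> fst x" "v \<in> U \<longleftrightarrow> fst x \<in> U"
      using side_other[OF fx] .
    then have "(fst z, v) \<in> parcs Y" using base_arc[OF fz v(1)] 2(1) by argo
    from nbr_exists[OF z this v(1)] obtain y where y: "(z, y) \<in> parcs X" "fst y = v" .
    show ?thesis using 2 v y(2) arc_sym[OF y(1)] by (intro exI[of _ y]) (auto simp: cover_dist_def)
  next
    case 3
    then have "common_nbrs x z \<noteq> {}"
      using card_common_eq[OF x z] common_pos by fastforce
    then obtain y where y: "(x, y) \<in> parcs X" "(y, z) \<in> parcs X"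
      unfolding common_nbrs_def by blast
    then show ?thesis using 3(3) arc_sides[OF y(1)] by (intro exI[of _ y]) (simp add: cover_dist_def)
  next
    case 4
    have "{y. (z, y) \<in> parcs X} \<noteq> {}" using card_nbrs_eq[OF z] deg_pos by fastforce
    then obtain y where y: "(z, y) \<in> parcs X" by blast
    have "(x, y) \<notin> parcs X"
      using nbr_unique[OF arc_sym arc_sym[OF y], of x] 4(2,3) by argo
    moreover have "\<not> same_side x y" using arc_sides[OF y] 4(1) by argo
    ultimately show ?thesis using 4(4) arc_sym[OF y] by (intro exI[of _ y]) (simp add: cover_dist_def)
  qed
qed

lemma graph_dist_cover:
  assumes "x \<in> pverts X" "y \<in> pverts X"
  shows "graph_dist X x y = ereal (real (cover_dist x y))"
proof (rule graph_dist_eqI)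
  show "pair_wf_digraph X" using pair_graph_total by (simp add: pair_graph_def pair_digraph_def pair_fin_digraph_def)
  show "cover_dist x z = 0 \<longleftrightarrow> z = x" for z by (auto simp: cover_dist_def)
qed (use assms cover_dist_step cover_dist_pred in auto)

lemma diameter: "graph_diameter X = 4"
  unfolding graph_diameter_def
proof (rule antisym)
  show "(SUP (u, v)\<in>pverts X \<times> pverts X. graph_dist X u v) \<le> 4"
    by (rule SUP_least) (auto simp: graph_dist_cover cover_dist_def)
  \<comment> \<open>Positions 1 and 2 of one fibre exist because \<open>r\<close> is at least 2, and
    they attain distance 4.\<close>
  obtain u where "u \<in> pverts Y" using parts by blast
  then have "(u, 1) \<in> pverts X" "(u, 2) \<in> pverts X" using r_ge_2 by (auto simp: verts)
  moreover from this have "graph_dist X (u, 1) (u, 2) = 4" by (simp add: graph_dist_cover cover_dist_def)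
  ultimately show "4 \<le> (SUP (u, v)\<in>pverts X \<times> pverts X. graph_dist X u v)"
    by (intro SUP_upper2[of "((u, 1), (u, 2))"]) auto
qed

section \<open>Bipartiteness, connectedness and intersection numbers\<close>

lemma arc_in_parts:
  assumes "(x, y) \<in> parcs X"
  shows "(x, y) \<in> (U \<times> {1..r}) \<times> (W \<times> {1..r}) \<union> (W \<times> {1..r}) \<times> (U \<times> {1..r})"
  using arc_base[OF assms] arc_verts[OF assms] arc_verts2[OF assms]
  unfolding arcs verts by (auto simp: mem_Times_iff)

lemma bipartite_cover: "bipartite X"
  unfolding bipartite_def
proof (intro exI conjI)
  show "pverts X = U \<times> {1..r} \<union> W \<times> {1..r}" using parts(1) by (auto simp: verts)
  show "(U \<times> {1..r}) \<inter> (W \<times> {1..r}) = {}" using parts(2) by auto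
  show "parcs X \<subseteq> (U \<times> {1..r}) \<times> (W \<times> {1..r}) \<union> (W \<times> {1..r}) \<times> (U \<times> {1..r})"
    using arc_in_parts by (intro subrelI)
qed

text \<open>All distances are finite by \<open>graph_dist_cover\<close>, so all vertices are
  mutually reachable.\<close>

lemma connected_cover: "Digraph_Component.connected (with_proj X)"
proof -
  interpret pair_wf_digraph X
    using pair_graph_total by (simp add: pair_graph_def pair_digraph_def pair_fin_digraph_def)
  have "x \<rightarrow>\<^sup>*\<^bsub>with_proj X\<^esub> y" if "x \<in> pverts X" "y \<in> pverts X" for x y
  proof -
    have "\<mu> (\<lambda>_. 1) x y < \<infinity>" using graph_dist_cover[OF that] by (simp add: graph_dist_def)
    then show ?thesis by (simp only: \<mu>_reach_conv)
  qed
  moreover have "pverts X \<noteq> {}" using parts r_ge_2 by (auto simp: verts)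
  ultimately show ?thesis
    by (auto simp: connected_def strongly_connected_def reachable_mk_symmetricI)
qed

text \<open>With n = \<open>deg\<close>, these are the c_i of the intersection array {n, n - 1, n -
  n/r, 1; 1, n/r, n - 1, n}. The last branch is c_4.\<close>

definition intersection_c :: "nat \<Rightarrow> nat" where
  "intersection_c i = (if i = 0 then 0 else if i = 1 then 1 else if i = 2 then common else if i = 3 then deg - 1 else deg)"

text \<open>The neighbours of \<open>w\<close> closer to \<open>x\<close> are \<open>x\<close> alone
  at distance 1, the common neighbours at distance 2, and all neighbours at distance 4. At distance
  3 the single exception is the neighbour of \<open>w\<close> in the fibre of \<open>x\<close>,
  which is antipodal to \<open>x\<close>.\<close>

lemma card_intersection_c:
  assumes x: "x \<in> pverts X" and w: "w \<in> pverts X"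
  shows "card {z. (w, z) \<in> parcs X \<and> Suc (cover_dist x z) = cover_dist x w} = intersection_c (cover_dist x w)"
proof -
  have fx: "fst x \<in> pverts Y" and fw: "fst w \<in> pverts Y" using x w by (auto simp: verts)
  consider "\<not> same_side x w" "(x, w) \<in> parcs X" "cover_dist x w = 1" | "\<not> same_side x w" "(x, w) \<notin> parcs X" "cover_dist x w = 3"
    | "same_side x w" "fst x \<noteq> fst w" "cover_dist x w = 2" | "same_side x w" "fst x = fst w" "x \<noteq> w" "cover_dist x w = 4"
    | "x = w" "cover_dist x w = 0"
    by (auto simp: cover_dist_def)
  then show ?thesis
  proof cases
    case 1
    have "{z. (w, z) \<in> parcs X \<and> Suc (cover_dist x z) = cover_dist x w} = {x}"
      unfolding 1(3) using arc_sym[OF 1(2)] by (auto simp: cover_dist_def split: if_splits)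
    then show ?thesis using 1 by (simp add: intersection_c_def)
  next
    case 2
    let ?F = "{z. (w, z) \<in> parcs X \<and> fst z = fst x}"
    have "Suc (cover_dist x z) = 3 \<longleftrightarrow> fst z \<noteq> fst x" if "(w, z) \<in> parcs X" for z
      using arc_sides[OF that] 2(1) by (auto simp: cover_dist_def)
    then have "{z. (w, z) \<in> parcs X \<and> Suc (cover_dist x z) = cover_dist x w} = {z. (w, z) \<in> parcs X} - ?F"
      unfolding 2(3) by blast
    moreover have "(fst w, fst x) \<in> parcs Y" using base_arc[OF fw fx] 2(1) by argo
    then have "card ?F = 1" using card_fibre[OF w fx] by (simp only: if_True)
    moreover have "finite ?F" by (rule finite_nbrs)
    ultimately show ?thesis using card_nbrs_eq[OF w] 2(3) card_Diff_subset[of ?F "{z. (w, z) \<in> parcs X}"]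
      by (simp add: intersection_c_def Collect_mono)
  next
    case 3
    have "{z. (w, z) \<in> parcs X \<and> Suc (cover_dist x z) = cover_dist x w} = common_nbrs x w"
      unfolding common_nbrs_def 3(3)
    proof (intro Collect_cong iffI)
      fix z assume "(w, z) \<in> parcs X \<and> Suc (cover_dist x z) = 2"
      then show "(x, z) \<in> parcs X \<and> (z, w) \<in> parcs X"
        using arc_sym[of w z] by (auto simp: cover_dist_def split: if_splits)
    next
      fix z assume "(x, z) \<in> parcs X \<and> (z, w) \<in> parcs X"
      then show "(w, z) \<in> parcs X \<and> Suc (cover_dist x z) = 2"
        using arc_sym[of z w] arc_sides[of x z] by (simp add: cover_dist_def)
    qed
    then show ?thesis using card_common_eq[OF x w] 3 by (simp add: intersection_c_def)
  next
    case 4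
    have "(x, z) \<notin> parcs X" if "(w, z) \<in> parcs X" for z
      using nbr_unique[OF arc_sym arc_sym[OF that], of x] 4(2,3) by argo
    then have "Suc (cover_dist x z) = 4" if "(w, z) \<in> parcs X" for z
      using arc_sides[OF that] that 4(1) by (auto simp: cover_dist_def)
    then have "{z. (w, z) \<in> parcs X \<and> Suc (cover_dist x z) = cover_dist x w} = {z. (w, z) \<in> parcs X}"
      unfolding 4(4) by blast
    then show ?thesis using card_nbrs_eq[OF w] 4 by (simp add: intersection_c_def)
  next
    case 5
    then show ?thesis by (simp add: intersection_c_def)
  qed
qed

text \<open>In a bipartite graph no neighbour of \<open>w\<close> is as far from \<open>x\<close> as
  \<open>w\<close> is. The outer neighbours are therefore the complement of the inner ones, and b_i
  = \<open>deg\<close> - c_i.\<close>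

lemma distance_regular_cover: "distance_regular X"
  unfolding distance_regular_def
proof (intro conjI allI exI ballI impI)
  show "pair_graph X" by (rule pair_graph_total)
  show "Digraph_Component.connected (with_proj X)" by (rule connected_cover)
  fix i :: nat and x w
  assume x: "x \<in> pverts X" and w: "w \<in> pverts X" and "graph_dist X x w = ereal (real i)"
  then have dw: "cover_dist x w = i" by (simp add: graph_dist_cover)
  let ?I = "{z. (w, z) \<in> parcs X \<and> Suc (cover_dist x z) = cover_dist x w}"
  let ?O = "{z. (w, z) \<in> parcs X \<and> cover_dist x z = Suc (cover_dist x w)}"
  \<comment> \<open>For \<open>i\<close> = 0 both sets are empty, since no distance equals -1 and no
    successor equals 0.\<close>
  have "{z. (w, z) \<in> parcs X \<and> graph_dist X x z = ereal (real i - 1)} = ?I"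
    using x dw by (auto simp: graph_dist_cover arc_verts2)
  then show inner: "card {z. (w, z) \<in> parcs X \<and> graph_dist X x z = ereal (real i - 1)} = intersection_c i"
    using card_intersection_c[OF x w] dw by simp
  have "Suc (cover_dist x z) = cover_dist x w \<or> cover_dist x z = Suc (cover_dist x w)" if wz: "(w, z) \<in> parcs X" for z
  proof -
    have "cover_dist x z \<noteq> cover_dist x w"
    proof (cases "same_side x w")
      case True
      then have "\<not> same_side x z" using arc_sides[OF wz] by argo
      from cover_dist_same[OF True] cover_dist_opposite[OF this] show ?thesis by simp
    next
      case False
      then have "same_side x z" using arc_sides[OF wz] by argo
      from cover_dist_same[OF this] cover_dist_opposite[OF False] show ?thesis by simp
    qed
    then show ?thesis
      using cover_dist_step[OF wz, of x] cover_dist_step[OF arc_sym[OF wz], of x] by linarith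
  qed
  then have split: "{z. (w, z) \<in> parcs X} = ?I \<union> ?O" by blast
  have "card {z. (w, z) \<in> parcs X} = card ?I + card ?O"
    unfolding split by (rule card_Un_disjoint) (auto simp: finite_nbrs)
  moreover have "{z. (w, z) \<in> parcs X \<and> graph_dist X x z = ereal (real i + 1)} = ?O"
    using x dw by (auto simp: graph_dist_cover arc_verts2)
  ultimately show "card {z. (w, z) \<in> parcs X \<and> graph_dist X x z = ereal (real i + 1)} = deg - intersection_c i"
    using card_intersection_c[OF x w] card_nbrs_eq[OF w] dw by simp
qed

end

section \<open>From arc functions to abstract covers, and the base with a single edge\<close>

lemma graph_cover_cover:
  assumes Y: "pair_graph Y" and G: "G \<subseteq> carrier (sym_group r)"
    and f: "symmetric_arc_function Y r G f"
  shows "graph_cover Y (cover Y r f) r"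
proof -
  have wf: "pair_wf_digraph Y"
    using Y by (simp add: pair_graph_def pair_digraph_def pair_fin_digraph_def)
  note in_verts = pair_wf_digraph.in_arcsD1[OF wf] pair_wf_digraph.in_arcsD2[OF wf]
  note base_sym = pair_graphD(2)[OF Y]
  have value_ex: "\<exists>g. f u v = Some g \<and> g \<in> carrier (sym_group r)"
    if "(u, v) \<in> parcs Y" for u v
  proof -
    have "f u v \<in> insert None (Some ` G)" "f u v \<noteq> None"
      using f in_verts[OF that] that unfolding symmetric_arc_function_def by blast+
    then show ?thesis using G by auto
  qed
  have mem: "((v, j), (u, k)) \<in> parcs (cover Y r f) \<longleftrightarrow>
      j \<in> {1..r} \<and> k \<in> {1..r} \<and> (v, u) \<in> parcs Y \<and> (\<exists>g. f u v = Some g \<and> g j = k)" for v j u k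
    by (simp add: cover_def)
  show ?thesis
  proof (rule graph_cover.intro)
    show "pair_graph Y" by (rule Y)
    show "pverts (cover Y r f) = pverts Y \<times> {1..r}" by (simp add: cover_def)
  next
    fix x y assume xy: "(x, y) \<in> parcs (cover Y r f)"
    obtain v j u k where [simp]: "x = (v, j)" "y = (u, k)" by (metis surj_pair)
    have *: "j \<in> {1..r}" "k \<in> {1..r}" "(v, u) \<in> parcs Y" "\<exists>g. f u v = Some g \<and> g j = k"
      using xy by (simp_all add: mem)
    show "x \<in> pverts (cover Y r f)" using * in_verts[OF *(3)] by (simp add: cover_def)
    obtain g where g: "f u v = Some g" "g j = k" using *(4) by blast
    have perm: "g permutes {1..r}"
      using value_ex[OF base_sym[OF *(3)]] g(1) by (simp add: sym_group_carrier)
    \<comment> \<open>The reversed arc carries the inverse permutation, which takes \<open>k\<close>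
      back to \<open>j\<close>.\<close>
    have "f v u = map_option (\<lambda>g. inv\<^bsub>sym_group r\<^esub> g) (f u v)"
      using f in_verts[OF *(3)] unfolding symmetric_arc_function_def by blast
    then have "f v u = Some (inv' g)" using g(1) perm by (simp add: sym_group_carrier)
    moreover have "inv' g k = j" using permutes_inverses(2)[OF perm, of j] g(2) by simp
    ultimately show "(y, x) \<in> parcs (cover Y r f)" using * base_sym by (simp add: mem)
  next
    fix x u assume x: "x \<in> pverts (cover Y r f)"
    obtain v j where [simp]: "x = (v, j)" by (metis surj_pair)
    have j: "j \<in> {1..r}" using x by (simp add: cover_def)
    let ?F = "{y. (x, y) \<in> parcs (cover Y r f) \<and> fst y = u}"
    show "card ?F = (if (fst x, u) \<in> parcs Y then 1 else 0)"
    proof (cases "(v, u) \<in> parcs Y")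
      case True
      obtain g where g: "f u v = Some g" "g permutes {1..r}"
        using value_ex[OF base_sym[OF True]] by (auto simp: sym_group_carrier)
      have "g j \<in> {1..r}" using permutes_in_image[OF g(2)] j by blast
      \<comment> \<open>A permutation sends \<open>j\<close> to exactly one position over
        \<open>u\<close>.\<close>
      then have "?F = {(u, g j)}" using True j g(1) by (auto simp: mem)
      then show ?thesis using True by simp
    next
      case False
      then have "?F = {}" by (auto simp: mem)
      then show ?thesis using False by (simp only: card.empty if_False fst_conv \<open>x = (v, j)\<close>)
    qed
  qed
qed

text \<open>A walk from \<open>u\<close> to \<open>w\<close> is nonempty because its ends differ;
  its first arc serves.\<close>

lemma connected_first_arc:
  assumes T: "pair_graph T" and conn: "Digraph_Component.connected (with_proj T)"
    and uw: "u \<in> pverts T" "w \<in> pverts T" "u \<noteq> w"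
  obtains x where "(u, x) \<in> parcs T"
proof -
  interpret pair_wf_digraph T
    using T by (simp add: pair_graph_def pair_digraph_def pair_fin_digraph_def)
  have "symmetric (with_proj T)"
    using T by (simp add: pair_graph_def pair_pseudo_graph_def pair_sym_digraph_def pair_sym_digraph_axioms_def)
  then have "strongly_connected (with_proj T)"
    using conn by (rule symmetric_connected_imp_strongly_connected)
  then have "u \<rightarrow>\<^sup>*\<^bsub>with_proj T\<^esub> w"
    using uw by (simp add: strongly_connected_def)
  then obtain p where p: "awalk u p w"
    unfolding reachable_awalk by blast
  then obtain e q where "p = e # q"
    using uw(3) by (cases p) (auto simp: awalk_Nil_iff)
  then have "(u, snd e) \<in> parcs T" using p by (simp add: awalk_Cons_iff)
  then show thesis by (rule that)
qed

text \<open>A spanning tree of a single edge contains that edge, so normalization makes every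
  nonzero value the identity.\<close>

lemma normalized_edge_trivial:
  assumes T: "undirected_spanning_tree T Y" and id: "\<forall>(u, v)\<in>parcs T. f u v = Some id"
    and Y: "pverts Y = {u, w}" "parcs Y = {(u, w), (w, u)}" "u \<noteq> w"
    and loops: "f u u = None" "f w w = None"
  shows "trivial_group (arc_function_group Y r f)"
proof -
  have pT: "pair_graph T" and sp: "pverts T = pverts Y" "parcs T \<subseteq> parcs Y"
    and conn: "Digraph_Component.connected (with_proj T)"
    using T by (simp_all add: undirected_spanning_tree_def spanning_def subgraph_def)
  have "u \<in> pverts T" "w \<in> pverts T" by (simp_all add: sp(1) Y(1))
  then obtain x where "(u, x) \<in> parcs T"
    by (rule connected_first_arc[OF pT conn _ _ Y(3)])
  moreover from this have "x = w" using subsetD[OF sp(2)] Y(2,3) by fastforce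
  ultimately have uw: "(u, w) \<in> parcs T" by simp
  then have "(w, u) \<in> parcs T" by (rule pair_graphD(2)[OF pT])
  then have vals: "f u w = Some id" "f w u = Some id"
    using bspec[OF id uw] bspec[OF id \<open>(w, u) \<in> parcs T\<close>] by simp_all
  have "{g. \<exists>u\<in>pverts Y. \<exists>v\<in>pverts Y. f u v = Some g} \<subseteq> {\<one>\<^bsub>sym_group r\<^esub>}"
    unfolding Y(1) sym_group_one by (simp add: loops vals)
  then show ?thesis
    unfolding arc_function_group_def
    by (rule group.trivial_group_subgroup_generated[OF sym_group_is_group])
qed

theorem corollary6p4:
  fixes Y :: "'v pair_pre_digraph"
    and r :: nat
    and G :: "(nat \<Rightarrow> nat) set"
    and f :: "'v \<Rightarrow> 'v \<Rightarrow> (nat \<Rightarrow> nat) option"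
  assumes "pair_graph Y"
    and "Digraph_Component.connected (with_proj Y)"
    and "subgroup G (sym_group r)"
    and "symmetric_arc_function Y r G f"
    and "normalized Y f"
    and "acts_regularly (arc_function_group Y r f) r"
    and "\<exists>m n. 1 \<le> m \<and> 1 \<le> n \<and> complete_bipartite_digraph m n (with_proj Y)"
    and "cyclic_group (arc_function_group Y r f)"
    and "two_ev_cover Y r f"
  shows "(\<exists>n. complete_bipartite_digraph n n (with_proj Y) \<and> r dvd n) \<and>
         bipartite (cover Y r f) \<and>
         distance_regular (cover Y r f) \<and>
         graph_diameter (cover Y r f) = 4"
proof -
  obtain U W where UW: "pverts Y = U \<union> W" "U \<inter> W = {}" "1 \<le> card U" "1 \<le> card W"
    "parcs Y = U \<times> W \<union> W \<times> U"
    using assms(7) unfolding complete_bipartite_digraph_pair_def by blast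
  have cov: "graph_cover Y (cover Y r f) r"
    by (rule graph_cover_cover[OF assms(1) subgroup.subset[OF assms(3)] assms(4)])
  interpret complete_bipartite_two_ev_cover Y "cover Y r f" r U W
  proof (intro complete_bipartite_two_ev_cover.intro complete_bipartite_two_ev_cover_axioms.intro)
    show "graph_cover Y (cover Y r f) r" by (rule cov)
    show "U \<noteq> {}" "W \<noteq> {}" using UW(3,4) by auto
    show "card (set_mset (Spec (cover Y r f) - Spec Y)) = 2"
      using assms(9) by (simp only: two_ev_cover_def)
  qed (use UW in auto)
  \<comment> \<open>For \<open>deg\<close> = 1 the base is a single edge and the group is trivial,
    but transitivity on at least two points asks for an element taking 1 to 2.\<close>
  have "2 \<le> deg"
  proof (rule ccontr)
    assume "\<not> 2 \<le> deg"
    then have "card U = 1" "card W = 1" using deg_pos card_U card_parts by simp_all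
    then obtain u w where uw: "U = {u}" "W = {w}" by (meson card_1_singletonE)
    then have Y: "pverts Y = {u, w}" "parcs Y = {(u, w), (w, u)}" "u \<noteq> w"
      using UW(1,2,5) by auto
    have none: "f x y = None" if "x \<in> pverts Y" "y \<in> pverts Y" "(x, y) \<notin> parcs Y" for x y
      using assms(4) that unfolding symmetric_arc_function_def by blast
    obtain T where T: "undirected_spanning_tree T Y" "\<forall>(u, v)\<in>parcs T. f u v = Some id"
      using assms(5) unfolding normalized_def by blast
    have "trivial_group (arc_function_group Y r f)"
      by (rule normalized_edge_trivial[OF T Y]) (use none Y in auto)
    then have "carrier (arc_function_group Y r f) = {id}"
      by (simp add: trivial_group_def arc_function_group_def sym_group_one)
    moreover have "\<exists>g. g \<in> carrier (arc_function_group Y r f) \<and> g 1 = 2"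
    proof -
      have "(1 :: nat) \<in> {1..r}" "2 \<in> {1..r}" using r_ge_2 by auto
      then show ?thesis using assms(6) unfolding acts_regularly_def by blast
    qed
    ultimately show False by auto
  qed
  then interpret nontrivial_cover Y "cover Y r f" r U W
    by unfold_locales
  have "finite (pverts Y)" by (rule finite_base)
  then have "complete_bipartite_digraph deg deg (with_proj Y)"
    unfolding complete_bipartite_digraph_pair_def using UW card_U card_parts by blast
  then show ?thesis
    using r_dvd bipartite_cover distance_regular_cover diameter by blast
qed

end
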